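(* Let $q,a,b,\xi>0$ with $a>1/q$ and $b-\frac1q\notin\mathbb{Z}$. Let $F$ be the cumulative distribution function of the $\mathrm{Gambel}$ distribution with parameters $q,a,b,\xi$, let $p\in(0,1)$ and $\theta^*:=F^{-1}(p)$. Then the Lorenz curve of this distribution at $p$ is $$\begin{aligned}L(p)=C\Bigg(&\theta^*\,\xi^b\,(bq+1)\,\phi(q)\,\Gamma\left(a+\tfrac1q\right)\Gamma\left(b-\tfrac1q+1\right)\,{}_2F_2\left(a+\tfrac1q,\tfrac2q;\,-b+\tfrac1q+1,\,1+\tfrac2q;\,\frac{\phi(q)^q(\theta^* )^q}{\xi}\right)\\&-2\,\xi^{1/q}\,\Gamma(a+b)\,(\theta^* )^{bq}\,\Gamma\left(-b+\tfrac1q+1\right)\phi(q)^{bq}\,{}_2F_2\left(a+b,\,b+\tfrac1q;\,b-\tfrac1q+1,\,b+\tfrac1q+1;\,\frac{\phi(q)^q(\theta^* )^q}{\xi}\right)\Bigg),\end{aligned}$$ where $$C=\frac{\pi\,\theta^*\,q\,\sqrt{\Gamma\left(\frac3q\right)}\;\xi^{-\frac{bq+2}{q}}\,\csc\left(\pi\left(b-\frac1q\right)\right)}{2(bq+1)\,\Gamma\left(\frac1q\right)^{3/2}\,\Gamma(a+b)\,B(a,b)}\times\frac{1}{\Gamma\left(b-\frac1q+1\right)\Gamma\left(-b+\frac1q+1\right)}\times\frac{\Gamma\left(\frac1q\right)\Gamma(a)\Gamma(b)}{\Gamma\left(\frac2q\right)\Gamma\left(a-\frac1q\right)\Gamma\left(b+\frac1q\right)},$$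 and where each product of the form $\frac{1}{\Gamma(b-\frac1q+1)\Gamma(-b+\frac1q+1)}\Gamma(\cdot)\,{}_2F_2(\cdots)$ is evaluated with these parameters.
   Context: For a distribution on $(0,\infty)$ with density $f$, cumulative distribution function $F$ and finite mean, the Lorenz curve is $$L(p)=\frac{\int_0^{F^{-1}(p)}x f(x)\,dx}{\int_0^{\infty}x f(x)\,dx},\qquad F^{-1}(p)=\inf\{x:F(x)\ge p\}.$$ $\phi(q)=\sqrt{\Gamma(3/q)/\Gamma(1/q)}$, $B$ is the Beta function, and ${}_2F_2(\alpha_1,\alpha_2;\beta_1,\beta_2;z)=\sum_{n\ge0}\frac{(\alpha_1)_n(\alpha_2)_n}{(\beta_1)_n(\beta_2)_n}\frac{z^n}{n!}$ is the generalised hypergeometric function. The distribution $\mathrm{Gambel}(\theta\mid q,a,b,\xi)$ is the distribution on $(0,\infty)$ with density $$\frac{\Gamma\left(a+\frac1q\right)}{\Gamma\left(\frac1q\right)}\,\frac{q}{B(a,b)}\,\frac{\phi(q)}{\xi^{1/q}}\,\Psi\left(a+\tfrac1q,\;1+\tfrac1q-b,\;\frac{(\phi(q)\,\theta)^q}{\xi}\right)\qquad(\theta>0),$$ where $\Psi(x,y,z)$ is the Tricomi confluent hypergeometric function, given for $y\notin\mathbb{Z}$ by $$\Psi(x,y,z)=\frac{\pi}{\sin(\pi y)}\left\{\frac{M(x,y,z)}{\Gamma(1+x-y)\Gamma(y)}-z^{1-y}\frac{M(1+x-y,2-y,z)}{\Gamma(x)\Gamma(2-y)}\right\},$$ with $M$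 the Kummer confluent hypergeometric function. *)

theory Defs
  imports "HOL-Probability.Probability"
begin

definition Kummer_M :: "real \<Rightarrow> real \<Rightarrow> real \<Rightarrow> real" where
  "Kummer_M x y z = (\<Sum>n. pochhammer x n / pochhammer y n * z ^ n / fact n)"

definition hypergeo_2F2 :: "real \<Rightarrow> real \<Rightarrow> real \<Rightarrow> real \<Rightarrow> real \<Rightarrow> real" where
  "hypergeo_2F2 \<alpha>1 \<alpha>2 \<beta>1 \<beta>2 z =
     (\<Sum>n. (pochhammer \<alpha>1 n * pochhammer \<alpha>2 n) / (pochhammer \<beta>1 n * pochhammer \<beta>2 n)
           * z ^ n / fact n)"

(* Tricomi's confluent hypergeometric function. The formula is meaningful for z > 0 and y not an
   integer; for integer y, sin (pi * y) = 0 and HOL's division makes the value 0 instead of the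
   limit value. *)
definition Tricomi_Psi :: "real \<Rightarrow> real \<Rightarrow> real \<Rightarrow> real" where
  "Tricomi_Psi x y z =
     pi / sin (pi * y) *
       (Kummer_M x y z / (Gamma (1 + x - y) * Gamma y)
        - z powr (1 - y) * Kummer_M (1 + x - y) (2 - y) z / (Gamma x * Gamma (2 - y)))"

definition phi :: "real \<Rightarrow> real" where
  "phi q = sqrt (Gamma (3 / q) / Gamma (1 / q))"

definition gambel_density :: "real \<Rightarrow> real \<Rightarrow> real \<Rightarrow> real \<Rightarrow> real \<Rightarrow> real" where
  "gambel_density q a b \<xi> \<theta> =
     (if \<theta> > 0 then
        Gamma (a + 1 / q) / Gamma (1 / q) * (q / Beta a b) * (phi q / \<xi> powr (1 / q))
        * Tricomi_Psi (a + 1 / q) (1 + 1 / q - b) ((phi q * \<theta>) powr q / \<xi>)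
      else 0)"

definition gambel :: "real \<Rightarrow> real \<Rightarrow> real \<Rightarrow> real \<Rightarrow> real measure" where
  "gambel q a b \<xi> = density lborel (\<lambda>\<theta>. ennreal (gambel_density q a b \<xi> \<theta>))"

definition quantile :: "(real \<Rightarrow> real) \<Rightarrow> real \<Rightarrow> real" where
  "quantile F p = Inf {x. F x \<ge> p}"

(* f is the density, with respect to Lebesgue measure, of a distribution on the positive half-line
   (so f vanishes elsewhere) with finite mean; cdf (density lborel f) is its distribution function. *)
definition lorenz_curve :: "(real \<Rightarrow> real) \<Rightarrow> real \<Rightarrow> real" where
  "lorenz_curve f p =
     (LBINT x:{0<..quantile (cdf (density lborel (\<lambda>x. ennreal (f x)))) p}. x * f x)
     / (LBINT x:{0<..}. x * f x)"

end

theory Submission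
  imports Defs "HOL-Real_Asymp.Real_Asymp"
begin

text \<open>
  For \<open>x > 0\<close>, \<open>1 + x - y > 0\<close> and non-integer \<open>y\<close> the Tricomi function is the Laplace integral
  \<open>\<Psi>(x, y, z) = 1 / \<Gamma>(x) \<integral> t\<^sup>x\<^sup>-\<^sup>1 (1 + t)\<^sup>y\<^sup>-\<^sup>x\<^sup>-\<^sup>1 e\<^sup>-\<^sup>z\<^sup>t dt\<close>. The integral and the two Kummer series solve the
  same second-order equation, so for \<open>0 < y < 1\<close> constancy of the Wronskians together with limits at 0
  identifies the integral with the combination of series. Differentiation in \<open>z\<close> relates
  \<open>(x, y)\<close> to \<open>(x + 1, y + 1)\<close>, which gives all \<open>y < 1\<close>, and Kummer's transformation
  \<open>y \<mapsto> 2 - y\<close> gives the rest.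

  The integral shows that the density is nonnegative, and by Tonelli it turns total mass and mean into
  Gamma and Beta integrals. The numerator of the Lorenz curve is an antiderivative of the series,
  because \<open>z\<^sup>s \<^sub>2F\<^sub>2(\<alpha>, s; \<beta>, s + 1; z)\<close> has derivative \<open>s z\<^sup>s\<^sup>-\<^sup>1 M(\<alpha>, \<beta>, z)\<close>. Total mass 1 is needed only
  to know that the quantile is an infimum over a nonempty set of positive numbers; should it be 0,
  both sides vanish.
\<close>

section \<open>Kummer's series\<close>

lemma pochhammer_ne_0:
  fixes y :: real
  assumes "y \<notin> \<int>"
  shows "pochhammer y n \<noteq> 0"
  using assms by (auto simp: pochhammer_eq_0_iff)

lemma add_nat_ne_0:
  fixes y :: real
  assumes "y \<notin> \<int>"
  shows "y + real n \<noteq> 0"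
  using assms by (metis Ints_minus Ints_of_nat add_eq_0_iff2)

text \<open>The power of \<open>z\<close> is kept outside, so that \<open>diffs\<close> and termwise
  differentiation of power series apply.\<close>

definition kummer_coeff :: "real \<Rightarrow> real \<Rightarrow> nat \<Rightarrow> real" where
  "kummer_coeff x y n = pochhammer x n / pochhammer y n / fact n"

lemma Kummer_M_eq: "Kummer_M x y z = (\<Sum>n. kummer_coeff x y n * z ^ n)"
  unfolding Kummer_M_def kummer_coeff_def by (simp add: mult_ac)

lemma kummer_coeff_Suc:
  assumes "y \<notin> \<int>"
  shows "kummer_coeff x y (Suc n) = kummer_coeff x y n * ((x + real n) / ((y + real n) * (real n + 1)))"
  unfolding kummer_coeff_def
  using pochhammer_ne_0[OF assms] add_nat_ne_0[OF assms, of n] by (simp add: pochhammer_Suc field_simps)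

text \<open>The ratio of consecutive terms is of order \<open>z / n\<close>, so the ratio test
  succeeds for every \<open>z\<close>.\<close>

lemma summable_kummer:
  assumes "y \<notin> \<int>"
  shows "summable (\<lambda>n. kummer_coeff x y n * z ^ n)"
proof -
  have "((\<lambda>n. (x + real n) / ((y + real n) * (real n + 1)) * z) \<longlongrightarrow> 0) at_top"
    by real_asymp
  then have "eventually (\<lambda>n. norm ((x + real n) / ((y + real n) * (real n + 1)) * z) < 1/2) at_top"
    unfolding tendsto_iff dist_real_def by (auto simp del: norm_divide norm_mult dest: spec[of _ "1/2"])
  then obtain N where N: "\<And>n. n \<ge> N \<Longrightarrow> norm ((x + real n) / ((y + real n) * (real n + 1)) * z) < 1/2"
    unfolding eventually_sequentially by blast
  show ?thesis
  proof (rule summable_ratio_test[of "1/2" N])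
    fix n assume "n \<ge> N"
    have "kummer_coeff x y (Suc n) * z ^ Suc n =
        ((x + real n) / ((y + real n) * (real n + 1)) * z) * (kummer_coeff x y n * z ^ n)"
      by (simp add: kummer_coeff_Suc[OF assms])
    then show "norm (kummer_coeff x y (Suc n) * z ^ Suc n) \<le> 1/2 * norm (kummer_coeff x y n * z ^ n)"
      using N[OF \<open>n \<ge> N\<close>] by (metis (no_types, lifting) less_imp_le mult_right_mono norm_ge_zero norm_mult)
  qed simp
qed

lemma sums_kummer:
  assumes "y \<notin> \<int>"
  shows "(\<lambda>n. kummer_coeff x y n * z ^ n) sums Kummer_M x y z"
  using summable_sums[OF summable_kummer[OF assms]] by (simp add: Kummer_M_eq)

text \<open>One factor splits off the front of each Pochhammer symbol, and the \<open>n + 1\<close>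
  from \<open>diffs\<close> cancels against the factorial.\<close>

lemma diffs_kummer_coeff:
  assumes "y \<notin> \<int>"
  shows "diffs (kummer_coeff x y) n = x / y * kummer_coeff (x + 1) (y + 1) n"
proof -
  have "y + 1 \<notin> \<int>" using assms by simp
  with assms have "pochhammer (y + 1) n \<noteq> 0" "y \<noteq> 0" "pochhammer y (Suc n) \<noteq> 0"
    using pochhammer_ne_0 by auto
  then show ?thesis
    by (simp add: diffs_def kummer_coeff_def pochhammer_rec divide_simps del: of_nat_Suc) 
qed

lemma Kummer_M_has_derivative:
  assumes "y \<notin> \<int>"
  shows "(Kummer_M x y has_real_derivative x / y * Kummer_M (x + 1) (y + 1) z) (at z)"
proof -
  have y1: "y + 1 \<notin> \<int>" using assms by simp
  have "((\<lambda>z. \<Sum>n. kummer_coeff x y n * z ^ n) has_real_derivative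
      (\<Sum>n. diffs (kummer_coeff x y) n * z ^ n)) (at z)"
    by (rule termdiffs_strong_converges_everywhere) (rule summable_kummer[OF assms])
  moreover have "(\<Sum>n. diffs (kummer_coeff x y) n * z ^ n) = x / y * Kummer_M (x + 1) (y + 1) z"
    using sums_mult[OF sums_kummer[OF y1], of "x / y" "x + 1" z]
    by (simp add: diffs_kummer_coeff[OF assms] sums_iff mult_ac)
  ultimately show ?thesis by (simp add: Kummer_M_eq[abs_def])
qed

lemma isCont_Kummer_M:
  assumes "y \<notin> \<int>"
  shows "isCont (Kummer_M x y) z"
  using Kummer_M_has_derivative[OF assms] DERIV_isCont by blast

lemma Kummer_M_0: "Kummer_M x y 0 = 1"
  using powser_zero[of "kummer_coeff x y"] by (simp add: Kummer_M_eq kummer_coeff_def)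

section \<open>Series with a power prefactor, and contiguous relations\<close>

text \<open>Termwise differentiation of \<open>z powr (s + n)\<close>. The coefficients are
  arbitrary because both Kummer series and the hypergeometric antiderivatives are treated this
  way.\<close>

lemma powr_power_series_has_derivative:
  fixes z :: real
  assumes sm: "\<And>z. summable (\<lambda>n. d n * z ^ n)" and "z > 0"
  shows "((\<lambda>z. z powr s * (\<Sum>n. d n * z ^ n)) has_real_derivative
      z powr (s - 1) * (\<Sum>n. (s + real n) * d n * z ^ n)) (at z)"
proof -
  have der: "((\<lambda>z. \<Sum>n. d n * z ^ n) has_real_derivative (\<Sum>n. diffs d n * z ^ n)) (at z)"
    by (rule termdiffs_strong_converges_everywhere[OF sm])
  have "(\<lambda>n. real n * d n * z ^ (n - Suc 0)) sums (\<Sum>n. diffs d n * z ^ n)"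
    using diffs_equiv[OF termdiff_converges_all[OF sm, of z]] by simp
  \<comment> \<open>Multiplication by \<open>z\<close> restores the exponent \<open>n\<close>; the
    term \<open>n = 0\<close>, where \<open>n - Suc 0\<close> truncates, carries the factor
    0.\<close>
  from sums_mult[OF this, of z]
  have "(\<lambda>n. real n * d n * z ^ n) sums (z * (\<Sum>n. diffs d n * z ^ n))"
    by (rule back_subst[of "\<lambda>f. f sums _"]) (auto simp: fun_eq_iff gr0_conv_Suc power_eq_if)
  from sums_add[OF sums_mult[OF summable_sums[OF sm], of s z] this]
  have "(\<lambda>n. (s + real n) * d n * z ^ n) sums
      (s * (\<Sum>n. d n * z ^ n) + z * (\<Sum>n. diffs d n * z ^ n))"
    by (simp add: algebra_simps)
  then have eq: "(\<Sum>n. (s + real n) * d n * z ^ n) =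
      s * (\<Sum>n. d n * z ^ n) + z * (\<Sum>n. diffs d n * z ^ n)"
    by (simp add: sums_iff)
  have zz: "z powr s = z powr (s - 1) * z" using \<open>z > 0\<close> by (simp add: powr_diff)
  show ?thesis
    by (rule derivative_eq_intros der refl \<open>z > 0\<close>)+
      (simp only: eq zz, simp add: algebra_simps)
qed

text \<open>Since \<open>pochhammer y n * (y + n) = y * pochhammer (y + 1) n\<close>, the factor
  \<open>y + n\<close> created by differentiation lowers the second parameter from
  \<open>y + 1\<close> to \<open>y\<close>.\<close>

lemma powr_Kummer_M_has_derivative:
  assumes "y \<notin> \<int>" "z > 0"
  shows "((\<lambda>z. z powr y * Kummer_M x (y + 1) z) has_real_derivative
      y * z powr (y - 1) * Kummer_M x y z) (at z)"
proof -
  have y1: "y + 1 \<notin> \<int>" using assms by simp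
  have "(y + real n) * kummer_coeff x (y + 1) n = y * kummer_coeff x y n" for n
    using pochhammer_ne_0[OF assms(1), of n] pochhammer_ne_0[OF y1, of n] pochhammer_rec[of y n]
      pochhammer_Suc[of y n]
    by (simp add: kummer_coeff_def divide_simps mult_ac)
  then have "(\<Sum>n. (y + real n) * kummer_coeff x (y + 1) n * z ^ n) = y * Kummer_M x y z"
    using sums_mult[OF sums_kummer[OF assms(1), of x z], of y] by (simp add: sums_iff mult_ac)
  then show ?thesis
    using powr_power_series_has_derivative[OF summable_kummer[OF y1, of x], of z y] assms(2)
    by (simp add: Kummer_M_eq[of x "y + 1"] mult_ac)
qed

text \<open>By comparison of coefficients. It supplies the second equation of the system in
  \<open>kummer_system_M\<close>.\<close>

lemma Kummer_M_contiguous_right: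
  assumes "y \<notin> \<int>"
  shows "Kummer_M (x + 1) y z - z / y * Kummer_M (x + 1) (y + 1) z = Kummer_M x y z"
proof -
  have y1: "y + 1 \<notin> \<int>" and y0: "y \<noteq> 0" using assms by auto
  \<comment> \<open>The coefficients of the subtracted series, moved up one index by its factor
    \<open>z\<close>.\<close>
  define c where "c n = (case n of 0 \<Rightarrow> 0 | Suc m \<Rightarrow> kummer_coeff (x + 1) (y + 1) m / y)" for n
  have "(\<lambda>n. c (Suc n) * z ^ Suc n) sums (z / y * Kummer_M (x + 1) (y + 1) z)"
    using sums_mult[OF sums_kummer[OF y1, of "x + 1" z], of "z / y"]
    by (simp add: c_def mult_ac)
  then have c: "(\<lambda>n. c n * z ^ n) sums (z / y * Kummer_M (x + 1) (y + 1) z)"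
    by (subst (asm) sums_Suc_iff) (simp add: c_def)
  have "kummer_coeff (x + 1) y n - c n = kummer_coeff x y n" for n
  proof (cases n)
    case (Suc m)
    have "pochhammer (x + 1) (Suc m) - real (Suc m) * pochhammer (x + 1) m = x * pochhammer (x + 1) m"
      by (simp add: pochhammer_Suc algebra_simps)
    then show ?thesis
      using pochhammer_ne_0[OF y1, of m] pochhammer_ne_0[OF assms, of n] y0
      unfolding Suc c_def kummer_coeff_def nat.case pochhammer_rec[of y] pochhammer_rec[of x]
      by (simp add: divide_simps del: of_nat_Suc) (simp add: algebra_simps)
  qed (simp add: c_def kummer_coeff_def)
  then have "(\<lambda>n. kummer_coeff x y n * z ^ n) sums
      (Kummer_M (x + 1) y z - z / y * Kummer_M (x + 1) (y + 1) z)"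
    using sums_diff[OF sums_kummer[OF assms, of "x + 1" z] c] by (simp flip: left_diff_distrib)
  then show ?thesis using sums_kummer[OF assms, of x z] sums_unique2 by blast
qed

text \<open>Both terms on the left have coefficients proportional to
  \<open>kummer_coeff x y n\<close>, with factors \<open>x + n\<close> and \<open>y - 1 + n\<close>,
  so \<open>n\<close> drops out of the difference. It supplies the second equation in
  \<open>kummer_system_powr_M\<close>.\<close>

lemma Kummer_M_contiguous_left:
  assumes "y \<notin> \<int>"
  shows "x * Kummer_M (x + 1) y z - (y - 1) * Kummer_M x (y - 1) z = (x - y + 1) * Kummer_M x y z"
proof -
  have y1: "y - 1 \<notin> \<int>" using assms by (metis Ints_1 Ints_add diff_add_cancel)
  have y0: "y - 1 \<noteq> 0" using y1 by auto
  have "x * kummer_coeff (x + 1) y n - (y - 1) * kummer_coeff x (y - 1) n = (x - y + 1) * kummer_coeff x y n" for n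
  proof -
    have "x * pochhammer (x + 1) n = (x + real n) * pochhammer x n"
      using pochhammer_rec[of x n] pochhammer_Suc[of x n] by (simp add: mult_ac)
    moreover have "(y - 1) * kummer_coeff x (y - 1) n = (y - 1 + real n) * kummer_coeff x y n"
      using pochhammer_rec[of "y - 1" n] pochhammer_Suc[of "y - 1" n]
        pochhammer_ne_0[OF assms, of n] pochhammer_ne_0[OF y1, of n]
      by (simp add: kummer_coeff_def divide_simps mult_ac)
    ultimately show ?thesis by (simp add: kummer_coeff_def flip: diff_divide_distrib left_diff_distrib)
  qed
  then show ?thesis
    using sums_diff[OF sums_mult[OF sums_kummer[OF assms, of "x + 1" z], of x]
        sums_mult[OF sums_kummer[OF y1, of x z], of "y - 1"]]
      sums_mult[OF sums_kummer[OF assms, of x z], of "x - y + 1"] sums_unique2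
    by (force simp flip: mult.assoc left_diff_distrib)
qed

section \<open>Laplace integrals\<close>

text \<open>The substitution \<open>u = A * t powr q\<close> in the Gamma integral. The result is
  put as a nonnegative integral, ready for Tonelli.\<close>

lemma nn_integral_generalised_Gamma:
  fixes s q A :: real
  assumes "s > 0" "q > 0" "A > 0"
  shows "(\<integral>\<^sup>+t\<in>{0<..}. ennreal (t powr (s - 1) * exp (- (A * t powr q))) \<partial>lborel)
       = ennreal (Gamma (s / q) / (q * A powr (s / q)))"
proof -
  define f where "f u = u powr (s / q - 1) / exp u" for u :: real
  define g where "g t = A * t powr q" for t
  define g' where "g' t = A * (q * t powr (q - 1))" for t
  have sq: "s / q > 0" using assms by simp
  have "(f has_integral Gamma (s / q)) {0..}"
    unfolding f_def by (rule Gamma_integral_real[OF sq])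
  \<comment> \<open>The point 0 is removed because the substitution runs over the open
    half-line.\<close>
  then have "((\<lambda>t. if t \<in> {0<..} then f t else 0) has_integral Gamma (s / q)) {0..}"
    by (rule has_integral_spike[of "{0}", rotated 2]) auto
  then have fI: "(f has_integral Gamma (s / q)) {0<..}"
    by (subst (asm) has_integral_restrict) auto
  have img: "g ` {0<..} = {0<..}"
  proof -
    have "u \<in> g ` {0<..}" if "u > 0" for u
      by (rule image_eqI[of _ _ "(u / A) powr (1 / q)"]) (use that assms in \<open>auto simp: g_def powr_powr\<close>)
    then show ?thesis using assms by (auto simp: g_def)
  qed
  have inj: "inj_on g {0<..}"
    by (rule inj_on_inverseI[where g = "\<lambda>u. (u / A) powr (1 / q)"])
      (use assms in \<open>auto simp: g_def powr_powr\<close>)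
  have der: "(g has_field_derivative g' t) (at t within {0<..})" if "t \<in> {0<..}" for t
    unfolding g_def g'_def using that by (auto intro!: derivative_eq_intros)
  have "f absolutely_integrable_on g ` {0<..} \<and> integral (g ` {0<..}) f = Gamma (s / q)"
    unfolding img using fI
    by (auto intro!: nonnegative_absolutely_integrable_1 simp: f_def integrable_on_def integral_unique)
  then have "(\<lambda>t. \<bar>g' t\<bar> * f (g t)) absolutely_integrable_on {0<..} \<and>
      integral {0<..} (\<lambda>t. \<bar>g' t\<bar> * f (g t)) = Gamma (s / q)"
    by (subst has_absolute_integral_change_of_variables_1'[OF _ der inj]) auto
  then have "((\<lambda>t. \<bar>g' t\<bar> * f (g t)) has_integral Gamma (s / q)) {0<..}"
    by (auto simp: absolutely_integrable_on_def has_integral_iff)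
  \<comment> \<open>The substituted integrand is the wanted one times
    \<open>q * A powr (s / q)\<close>.\<close>
  from has_integral_mult_left[OF this, of "1 / (q * A powr (s / q))"]
  have "((\<lambda>t. \<bar>g' t\<bar> * f (g t) * (1 / (q * A powr (s / q)))) has_integral
      Gamma (s / q) / (q * A powr (s / q))) {0<..}"
    by simp
  also have "?this \<longleftrightarrow> ((\<lambda>t. t powr (s - 1) * exp (- (A * t powr q))) has_integral
      Gamma (s / q) / (q * A powr (s / q))) {0<..}"
  proof (rule has_integral_cong)
    fix t :: real assume "t \<in> {0<..}"
    then have t: "t > 0" by simp
    have "(t powr q) powr (s / q - 1) = t powr (s - q)"
      using assms by (simp add: powr_powr right_diff_distrib)
    moreover have "t powr (s - 1) = t powr (q - 1) * t powr (s - q)"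
      by (simp flip: powr_add)
    moreover have "A powr (s / q) = A * A powr (s / q - 1)"
      using assms by (simp add: powr_diff)
    ultimately show "\<bar>g' t\<bar> * f (g t) * (1 / (q * A powr (s / q))) = t powr (s - 1) * exp (- (A * t powr q))"
      using assms t by (simp add: f_def g_def g'_def powr_mult exp_minus field_simps abs_mult)
  qed
  finally show ?thesis
    by (intro nn_integral_has_integral_lebesgue') auto
qed

lemma nn_integral_Gamma_scaled:
  fixes s z :: real
  assumes "s > 0" "z > 0"
  shows "(\<integral>\<^sup>+t\<in>{0<..}. ennreal (t powr (s - 1) * exp (- (z * t))) \<partial>lborel)
       = ennreal (Gamma s / z powr s)"
proof -
  have "(\<integral>\<^sup>+t\<in>{0<..}. ennreal (t powr (s - 1) * exp (- (z * t))) \<partial>lborel)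
      = (\<integral>\<^sup>+t\<in>{0<..}. ennreal (t powr (s - 1) * exp (- (z * t powr 1))) \<partial>lborel)"
    by (intro nn_integral_cong) (auto split: split_indicator)
  then show ?thesis
    using nn_integral_generalised_Gamma[of s 1 z] assms by simp
qed

text \<open>Both sides become the same double integral once \<open>(1 + t) powr (- c)\<close> is written as a Gamma
  integral.\<close>

lemma nn_integral_Laplace_swap:
  fixes a c z :: real
  assumes "a > 0" "c > 0" "z \<ge> 0"
  shows "(\<integral>\<^sup>+t\<in>{0<..}. ennreal (t powr (a - 1) * (1 + t) powr (- c) * exp (- (z * t))) \<partial>lborel)
       = ennreal (Gamma a / Gamma c) *
         (\<integral>\<^sup>+s\<in>{0<..}. ennreal (s powr (c - 1) * (z + s) powr (- a) * exp (- s)) \<partial>lborel)"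
proof -
  \<comment> \<open>The exponent also equals \<open>- (z * t) - (1 + t) * s\<close>. Integration
    over \<open>s\<close> is therefore a Gamma integral of rate \<open>1 + t\<close>, and
    integration over \<open>t\<close> one of rate \<open>z + s\<close>.\<close>
  define K where "K t s = ennreal (1 / Gamma c * indicator {0<..} t * indicator {0<..} s *
    (t powr (a - 1) * s powr (c - 1) * exp (- s - (z + s) * t)))" for t s :: real
  have G: "Gamma a > 0" "Gamma c > 0" using assms by (auto intro: Gamma_real_pos)
  have "(\<integral>\<^sup>+t\<in>{0<..}. ennreal (t powr (a - 1) * (1 + t) powr (- c) * exp (- (z * t))) \<partial>lborel)
      = (\<integral>\<^sup>+t. \<integral>\<^sup>+s. K t s \<partial>lborel \<partial>lborel)"
  proof (rule nn_integral_cong)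
    fix t :: real
    show "ennreal (t powr (a - 1) * (1 + t) powr (- c) * exp (- (z * t))) * indicator {0<..} t = 
      (\<integral>\<^sup>+s. K t s \<partial>lborel)"
    proof (cases "t > 0")
      case True
      have "(\<integral>\<^sup>+s. K t s \<partial>lborel) = (\<integral>\<^sup>+s. ennreal (1 / Gamma c * (t powr (a - 1) * exp (- (z * t)))) *
          (ennreal (s powr (c - 1) * exp (- ((1 + t) * s))) * indicator {0<..} s) \<partial>lborel)"
        using G True
        by (intro nn_integral_cong)
          (auto simp: K_def ennreal_mult[symmetric] exp_add[symmetric] algebra_simps split: split_indicator)
      also have "\<dots> = ennreal (1 / Gamma c * (t powr (a - 1) * exp (- (z * t)))) * ennreal (Gamma c / (1 + t) powr c)"
        using assms True by (subst nn_integral_cmult) (auto simp: nn_integral_Gamma_scaled)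
      also have "\<dots> = ennreal (t powr (a - 1) * (1 + t) powr (- c) * exp (- (z * t)))"
        using G by (subst ennreal_mult[symmetric]) (auto simp: powr_minus field_simps)
      finally show ?thesis using True by simp
    qed (simp add: K_def)
  qed
  also have "\<dots> = (\<integral>\<^sup>+s. \<integral>\<^sup>+t. K t s \<partial>lborel \<partial>lborel)"
    by (rule lborel_pair.Fubini') (unfold K_def case_prod_beta, measurable)
  also have "\<dots> = (\<integral>\<^sup>+s. ennreal (Gamma a / Gamma c) * (ennreal (s powr (c - 1) * (z + s) powr (- a) * exp (- s)) * indicator {0<..} s) \<partial>lborel)"
  proof (rule nn_integral_cong)
    fix s :: real
    show "(\<integral>\<^sup>+t. K t s \<partial>lborel) =
      ennreal (Gamma a / Gamma c) * (ennreal (s powr (c - 1) * (z + s) powr (- a) * exp (- s)) * indicator {0<..} s)"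
    proof (cases "s > 0")
      case True
      have "(\<integral>\<^sup>+t. K t s \<partial>lborel) = (\<integral>\<^sup>+t. ennreal (1 / Gamma c * (s powr (c - 1) * exp (- s))) *
          (ennreal (t powr (a - 1) * exp (- ((z + s) * t))) * indicator {0<..} t) \<partial>lborel)"
        using G True
        by (intro nn_integral_cong)
          (auto simp: K_def ennreal_mult[symmetric] exp_add[symmetric] algebra_simps split: split_indicator)
      also have "\<dots> = ennreal (1 / Gamma c * (s powr (c - 1) * exp (- s))) * ennreal (Gamma a / (z + s) powr a)"
        using assms True by (subst nn_integral_cmult) (auto simp: nn_integral_Gamma_scaled)
      also have "\<dots> = ennreal (Gamma a / Gamma c) * ennreal (s powr (c - 1) * (z + s) powr (- a) * exp (- s))"
        using G by (subst (1 2) ennreal_mult[symmetric]) (auto simp: powr_minus field_simps)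
      finally show ?thesis using True by simp
    qed (simp add: K_def)
  qed
  also have "\<dots> = ennreal (Gamma a / Gamma c) * (\<integral>\<^sup>+s\<in>{0<..}. ennreal (s powr (c - 1) * (z + s) powr (- a) * exp (- s)) \<partial>lborel)"
    by (rule nn_integral_cmult) simp
  finally show ?thesis .
qed

text \<open>The swap at \<open>z = 0\<close>: the powers of \<open>s\<close> merge into
  \<open>s powr (b - 1)\<close> and leave a plain Gamma integral.\<close>

lemma nn_integral_Beta:
  fixes a b :: real
  assumes "a > 0" "b > 0"
  shows "(\<integral>\<^sup>+t\<in>{0<..}. ennreal (t powr (a - 1) * (1 + t) powr (- (a + b))) \<partial>lborel) = ennreal (Beta a b)"
proof -
  have "(\<integral>\<^sup>+t\<in>{0<..}. ennreal (t powr (a - 1) * (1 + t) powr (- (a + b))) \<partial>lborel)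
      = ennreal (Gamma a / Gamma (a + b)) *
         (\<integral>\<^sup>+s\<in>{0<..}. ennreal (s powr (a + b - 1) * s powr (- a) * exp (- s)) \<partial>lborel)"
    using nn_integral_Laplace_swap[of a "a + b" 0] assms by simp
  also have "(\<integral>\<^sup>+s\<in>{0<..}. ennreal (s powr (a + b - 1) * s powr (- a) * exp (- s)) \<partial>lborel)
      = (\<integral>\<^sup>+s\<in>{0<..}. ennreal (s powr (b - 1) * exp (- (1 * s))) \<partial>lborel)"
    by (intro nn_integral_cong) (auto simp flip: powr_add split: split_indicator)
  also have "\<dots> = ennreal (Gamma b)" using nn_integral_Gamma_scaled[of b 1] assms by simp
  also have "ennreal (Gamma a / Gamma (a + b)) * ennreal (Gamma b) = ennreal (Beta a b)"
    using assms Gamma_real_pos[of b] by (subst ennreal_mult''[symmetric]) (auto simp: Beta_def intro: Gamma_real_pos less_imp_le)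
  finally show ?thesis .
qed

section \<open>The Laplace integral of the Tricomi function\<close>

text \<open>For \<open>c = y - x - 1\<close> this is \<open>Gamma x\<close> times the classical
  Laplace integral. Taking \<open>c\<close> instead of \<open>y\<close> as parameter keeps it fixed
  when differentiation raises \<open>x\<close> and \<open>y\<close> together.\<close>

definition confluent_integral :: "real \<Rightarrow> real \<Rightarrow> real \<Rightarrow> real" where
  "confluent_integral x c z = (LBINT t:{0<..}. t powr (x - 1) * (1 + t) powr c * exp (- (z * t)))"

text \<open>The power is at most \<open>(1 + t) ^ n\<close> for some natural \<open>n\<close>, and a
  single term of the exponential series bounds that. The rate \<open>e\<close> can be chosen below
  any available decay.\<close>

lemma one_plus_powr_le_exp:
  fixes c e :: real
  assumes "e > 0"
  obtains K where "K \<ge> 0" "\<And>t. t > 0 \<Longrightarrow> (1 + t) powr c \<le> K * exp (e * t)"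
proof -
  obtain n :: nat where n: "c \<le> real n" using real_arch_simple by blast
  show ?thesis
  proof
    show "fact n / e ^ n * exp e \<ge> (0::real)" using assms by simp
    fix t :: real assume t: "t > 0"
    have "(1 + t) powr c \<le> (1 + t) ^ n"
      using n t by (simp flip: powr_realpow)
    also have "\<dots> \<le> fact n / e ^ n * exp (e * (1 + t))"
    proof -
      have "(e * (1 + t)) ^ n / fact n \<le> exp (e * (1 + t))"
      proof -
        have "(\<Sum>k\<in>{n}. (e * (1 + t)) ^ k / fact k) \<le> (\<Sum>k. (e * (1 + t)) ^ k / fact k)"
          using summable_exp_generic[of "e * (1 + t)"] assms t
          by (intro sum_le_suminf) (auto simp: divide_inverse mult_ac)
        then show ?thesis by (simp add: exp_def divide_inverse mult_ac)
      qed
      then have "e ^ n * (1 + t) ^ n \<le> fact n * exp (e * (1 + t))"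
        by (simp add: power_mult_distrib pos_divide_le_eq mult.commute)
      then show ?thesis using assms by (simp add: pos_le_divide_eq mult.commute)
    qed
    also have "\<dots> = fact n / e ^ n * exp e * exp (e * t)" by (simp add: ring_distribs exp_add)
    finally show "(1 + t) powr c \<le> fact n / e ^ n * exp e * exp (e * t)" .
  qed
qed

lemma set_integrable_Gamma_scaled:
  fixes s z :: real
  assumes "s > 0" "z > 0"
  shows "set_integrable lborel {0<..} (\<lambda>t. t powr (s - 1) * exp (- (z * t)))"
  unfolding set_integrable_def
proof (rule integrableI_nn_integral_finite)
  show "(\<integral>\<^sup>+t. ennreal (indicat_real {0<..} t *\<^sub>R (t powr (s - 1) * exp (- (z * t)))) \<partial>lborel) = ennreal (Gamma s / z powr s)"
    using nn_integral_Gamma_scaled[OF assms, unfolded nn_integral_set_ennreal] by (simp add: mult_ac)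
qed auto

lemma set_integrable_confluent:
  fixes x c z :: real
  assumes "x > 0" "z > 0"
  shows "set_integrable lborel {0<..} (\<lambda>t. t powr (x - 1) * (1 + t) powr c * exp (- (z * t)))"
proof -
  \<comment> \<open>Half of the decay rate absorbs the power of \<open>1 + t\<close>; the other half
    remains for a Gamma integral.\<close>
  obtain K where K: "K \<ge> 0" "\<And>t. t > 0 \<Longrightarrow> (1 + t) powr c \<le> K * exp (z / 2 * t)"
    using one_plus_powr_le_exp[of "z / 2" c] assms by auto
  show ?thesis
  proof (rule set_integrable_bound)
    show "set_integrable lborel {0<..} (\<lambda>t. K * (t powr (x - 1) * exp (- (z / 2 * t))))"
      using set_integrable_Gamma_scaled[of x "z / 2"] assms by simp
    show "AE t in lborel. t \<in> {0<..} \<longrightarrow> norm (t powr (x - 1) * (1 + t) powr c * exp (- (z * t)))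
      \<le> norm (K * (t powr (x - 1) * exp (- (z / 2 * t))))"
    proof (intro AE_I2 impI)
      fix t :: real assume t: "t \<in> {0<..}"
      have "(1 + t) powr c * exp (- (z * t)) \<le> K * exp (z / 2 * t) * exp (- (z * t))"
        using K t by (intro mult_right_mono) auto
      also have "\<dots> = K * exp (- (z / 2 * t))" by (simp flip: exp_add)
      finally show "norm (t powr (x - 1) * (1 + t) powr c * exp (- (z * t)))
        \<le> norm (K * (t powr (x - 1) * exp (- (z / 2 * t))))"
        using K t by (simp add: abs_mult mult.assoc mult.left_commute[of K] mult_left_mono)
    qed
  qed (simp add: set_borel_measurable_def)
qed

lemma nn_integral_confluent:
  assumes "x > 0" "z > 0"
  shows "(\<integral>\<^sup>+t\<in>{0<..}. ennreal (t powr (x - 1) * (1 + t) powr c * exp (- (z * t))) \<partial>lborel)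
    = ennreal (confluent_integral x c z)"
  unfolding nn_integral_set_ennreal
  using nn_integral_eq_integral[OF set_integrable_confluent[OF assms, of c, unfolded set_integrable_def]]
  by (simp add: confluent_integral_def set_lebesgue_integral_def mult_ac)

lemma confluent_integral_nonneg: "confluent_integral x c z \<ge> 0"
  unfolding confluent_integral_def set_lebesgue_integral_def by (intro Bochner_Integration.integral_nonneg) auto

text \<open>After the swap, \<open>s = z * u\<close> turns \<open>(z + s) powr (- x)\<close> into
  \<open>z powr (- x) * (1 + u) powr (- x)\<close>. With \<open>c = 1 + x - y\<close> this is
  Kummer's transformation from \<open>y\<close> to \<open>2 - y\<close> on the level of
  integrals.\<close>

lemma confluent_integral_Kummer:
  assumes "x > 0" "c > 0" "z > 0"
  shows "confluent_integral x (- c) z = Gamma x / Gamma c * z powr (c - x) * confluent_integral c (- x) z"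
proof -
  have G: "Gamma x > 0" "Gamma c > 0" using assms by (auto intro: Gamma_real_pos)
  have "ennreal (confluent_integral x (- c) z) = ennreal (Gamma x / Gamma c) *
         (\<integral>\<^sup>+s. ennreal (s powr (c - 1) * (z + s) powr (- x) * exp (- s)) * indicator {0<..} s \<partial>lborel)"
    using nn_integral_Laplace_swap[of x c z] assms by (simp flip: nn_integral_confluent)
  also have "(\<integral>\<^sup>+s. ennreal (s powr (c - 1) * (z + s) powr (- x) * exp (- s)) * indicator {0<..} s \<partial>lborel)
    = ennreal z * (\<integral>\<^sup>+u. ennreal ((0 + z * u) powr (c - 1) * (z + (0 + z * u)) powr (- x) * exp (- (0 + z * u))) * indicator {0<..} (0 + z * u) \<partial>lborel)"
    using assms by (subst nn_integral_real_affine[of _ z 0]) auto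
  also have "(\<integral>\<^sup>+u. ennreal ((0 + z * u) powr (c - 1) * (z + (0 + z * u)) powr (- x) * exp (- (0 + z * u))) * indicator {0<..} (0 + z * u) \<partial>lborel)
    = (\<integral>\<^sup>+u. ennreal (z powr (c - 1 - x)) * (ennreal (u powr (c - 1) * (1 + u) powr (- x) * exp (- (z * u))) * indicator {0<..} u) \<partial>lborel)"
  proof (rule nn_integral_cong)
    fix u :: real
    have "(z + z * u) powr (- x) = z powr (- x) * (1 + u) powr (- x)" if "u > 0"
      using that assms powr_mult[of z "1 + u" "- x"] by (simp add: ring_distribs)
    moreover have "z powr (c - 1 - x) = z powr (c - 1) * z powr (- x)"
      by (simp flip: powr_add)
    ultimately show "ennreal ((0 + z * u) powr (c - 1) * (z + (0 + z * u)) powr (- x) * exp (- (0 + z * u))) * indicator {0<..} (0 + z * u)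
      = ennreal (z powr (c - 1 - x)) * (ennreal (u powr (c - 1) * (1 + u) powr (- x) * exp (- (z * u))) * indicator {0<..} u)"
      using assms by (auto simp: powr_mult zero_less_mult_iff ennreal_mult[symmetric] mult_ac split: split_indicator)
  qed
  also have "\<dots> = ennreal (z powr (c - 1 - x)) * ennreal (confluent_integral c (- x) z)"
    using assms by (subst nn_integral_cmult) (auto simp: nn_integral_confluent)
  also have "ennreal (Gamma x / Gamma c) * (ennreal z * \<dots>) =
      ennreal (Gamma x / Gamma c * z powr (c - x) * confluent_integral c (- x) z)"
    using G assms confluent_integral_nonneg
    by (simp add: ennreal_mult[symmetric] powr_diff)
  finally show ?thesis
    using G confluent_integral_nonneg by simp
qed

lemma confluent_integral_has_derivative:
  assumes "x > 0" "z > 0"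
  shows "(confluent_integral x c has_real_derivative - confluent_integral (x + 1) c z) (at z)"
proof -
  \<comment> \<open>Dominated convergence is applied to the difference quotients. For increments in
    \<open>S\<close> the decay rate stays above \<open>z / 2\<close>, which gives a majorant
    independent of \<open>h\<close>.\<close>
  define S where "S = {- (z / 2)<..<z / 2}"
  have S: "open S" "0 \<in> S" using assms by (auto simp: S_def)
  define f where "f h t = indicat_real {0<..} t *\<^sub>R (t powr (x - 1) * (1 + t) powr c * ((exp (- ((z + h) * t)) - exp (- (z * t))) / h))"
    for h t :: real
  have int: "set_integrable lborel {0<..} (\<lambda>t. t powr (x - 1) * (1 + t) powr c * exp (- (y * t)))" if "y > 0" for y
    by (rule set_integrable_confluent[OF assms(1) that])
  have int1: "set_integrable lborel {0<..} (\<lambda>t. t powr x * (1 + t) powr c * exp (- (y * t)))" if "y > 0" for y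
    using set_integrable_confluent[of "x + 1" y c] assms(1) that by simp
  have quot: "(confluent_integral x c (z + h) - confluent_integral x c z) / h = integral\<^sup>L lborel (f h)"
    if "h \<in> S" for h
  proof -
    have "z + h > 0" using that by (auto simp: S_def)
    have "(confluent_integral x c (z + h) - confluent_integral x c z) =
      (LBINT t:{0<..}. t powr (x - 1) * (1 + t) powr c * exp (- ((z + h) * t)) - t powr (x - 1) * (1 + t) powr c * exp (- (z * t)))"
      unfolding confluent_integral_def
      by (rule set_integral_diff(2)[symmetric]; rule int) (use assms \<open>z + h > 0\<close> in auto)
    then have "(confluent_integral x c (z + h) - confluent_integral x c z) / h =
      (LBINT t:{0<..}. (t powr (x - 1) * (1 + t) powr c * exp (- ((z + h) * t)) - t powr (x - 1) * (1 + t) powr c * exp (- (z * t))) / h)"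
      by simp
    also have "\<dots> = integral\<^sup>L lborel (f h)"
      unfolding set_lebesgue_integral_def f_def by (simp add: right_diff_distrib diff_divide_distrib)
    finally show ?thesis .
  qed
  have "((\<lambda>h. (confluent_integral x c (z + h) - confluent_integral x c z) / h) \<longlongrightarrow> - confluent_integral (x + 1) c z) (at 0 within S)"
    unfolding tendsto_at_iff_sequentially
  proof (intro allI impI)
    fix X :: "nat \<Rightarrow> real" assume X: "\<forall>i. X i \<in> S - {0}" "X \<longlonglongrightarrow> 0"
    have "(\<lambda>i. integral\<^sup>L lborel (f (X i))) \<longlonglongrightarrow>
      integral\<^sup>L lborel (\<lambda>t. indicat_real {0<..} t *\<^sub>R (t powr (x - 1) * (1 + t) powr c * (- t * exp (- (z * t)))))"
    proof (rule integral_dominated_convergence)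
      show "integrable lborel (\<lambda>t. indicat_real {0<..} t *\<^sub>R (t powr x * (1 + t) powr c * exp (- (z / 2 * t))))"
        using int1[of "z / 2"] assms unfolding set_integrable_def by simp
      show "AE t in lborel. (\<lambda>i. f (X i) t) \<longlonglongrightarrow> indicat_real {0<..} t *\<^sub>R (t powr (x - 1) * (1 + t) powr c * (- t * exp (- (z * t))))"
      proof (rule AE_I2)
        fix t :: real
        have "((\<lambda>h. exp (- (h * t))) has_real_derivative - t * exp (- (z * t))) (at z)"
          by (auto intro!: derivative_eq_intros)
        then have "((\<lambda>h. (exp (- ((z + h) * t)) - exp (- (z * t))) / h) \<longlongrightarrow> - t * exp (- (z * t))) (at 0)"
          by (simp add: DERIV_def)
        then have "(\<lambda>i. (exp (- ((z + X i) * t)) - exp (- (z * t))) / X i) \<longlonglongrightarrow> - t * exp (- (z * t))"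
          using X unfolding tendsto_at_iff_sequentially by (auto simp: o_def)
        then show "(\<lambda>i. f (X i) t) \<longlonglongrightarrow> indicat_real {0<..} t *\<^sub>R (t powr (x - 1) * (1 + t) powr c * (- t * exp (- (z * t))))"
          unfolding f_def by (intro tendsto_intros)
      qed
      fix i
      show "AE t in lborel. norm (f (X i) t) \<le> indicat_real {0<..} t *\<^sub>R (t powr x * (1 + t) powr c * exp (- (z / 2 * t)))"
      proof (rule AE_I2)
        fix t :: real
        define h where "h = X i"
        have h: "h \<noteq> 0" "h \<in> S" using X by (auto simp: h_def)
        show "norm (f (X i) t) \<le> indicat_real {0<..} t *\<^sub>R (t powr x * (1 + t) powr c * exp (- (z / 2 * t)))"
        proof (cases "t > 0")
          case True
          \<comment> \<open>Mean value inequality on the convex set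
            \<open>{z / 2<..}\<close>.\<close>
          have "norm (exp (- (t * (z + h))) - exp (- (t * z))) \<le> (t * exp (- (z / 2 * t))) * norm (z + h - z)"
          proof (rule field_differentiable_bound[where S = "{z / 2<..}" and f' = "\<lambda>y. - t * exp (- (t * y))"])
            fix y assume y: "y \<in> {z / 2<..}"
            show "((\<lambda>y. exp (- (t * y))) has_real_derivative - t * exp (- (t * y))) (at y within {z / 2<..})"
              by (auto intro!: derivative_eq_intros)
            show "norm (- t * exp (- (t * y))) \<le> t * exp (- (z / 2 * t))"
              using True y by (simp add: abs_mult)
          qed (use h assms in \<open>auto simp: S_def\<close>)
          then have "\<bar>(exp (- ((z + h) * t)) - exp (- (z * t))) / h\<bar> \<le> t * exp (- (z / 2 * t))"
            using h by (simp add: abs_divide divide_le_eq mult_ac)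
          then have "t powr (x - 1) * (1 + t) powr c * \<bar>(exp (- ((z + h) * t)) - exp (- (z * t))) / h\<bar> \<le>
            t powr (x - 1) * (1 + t) powr c * (t * exp (- (z / 2 * t)))"
            by (intro mult_left_mono) auto
          also have "\<dots> = t powr x * (1 + t) powr c * exp (- (z / 2 * t))"
            using True by (simp add: powr_diff)
          finally show ?thesis
            using True by (simp add: f_def abs_mult flip: h_def)
        qed (simp add: f_def)
      qed
    qed (simp_all add: f_def[abs_def])
    moreover have "integral\<^sup>L lborel (\<lambda>t. indicat_real {0<..} t *\<^sub>R (t powr (x - 1) * (1 + t) powr c * (- t * exp (- (z * t)))))
      = - confluent_integral (x + 1) c z"
    proof -
      have "integral\<^sup>L lborel (\<lambda>t. indicat_real {0<..} t *\<^sub>R (t powr (x - 1) * (1 + t) powr c * (- t * exp (- (z * t)))))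
        = integral\<^sup>L lborel (\<lambda>t. - (indicat_real {0<..} t *\<^sub>R (t powr x * (1 + t) powr c * exp (- (z * t)))))"
        by (intro Bochner_Integration.integral_cong) (auto simp: powr_diff split: split_indicator)
      then show ?thesis unfolding confluent_integral_def set_lebesgue_integral_def by simp
    qed
    ultimately show "((\<lambda>h. (confluent_integral x c (z + h) - confluent_integral x c z) / h) \<circ> X) \<longlonglongrightarrow> - confluent_integral (x + 1) c z"
      using X(1) quot by (simp add: o_def)
  qed
  then show ?thesis
    unfolding DERIV_def at_within_open[OF S(2,1)] .
qed

text \<open>The integrand is dominated by its value at \<open>z = 0\<close>, which is a Beta
  integrand; \<open>x + c < 0\<close> makes it integrable at infinity.\<close>

lemma confluent_integral_at_0:
  assumes "x > 0" "x + c < 0"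
  shows "((confluent_integral x c) \<longlongrightarrow> Beta x (- c - x)) (at_right 0)"
  unfolding tendsto_at_iff_sequentially
proof (intro allI impI)
  fix X :: "nat \<Rightarrow> real" assume X: "\<forall>i. X i \<in> {0<..} - {0}" "X \<longlonglongrightarrow> 0"
  define w where "w t = indicat_real {0<..} t *\<^sub>R (t powr (x - 1) * (1 + t) powr c)" for t
  have w: "(\<integral>\<^sup>+t. ennreal (w t) \<partial>lborel) = ennreal (Beta x (- c - x))"
    using nn_integral_Beta[of x "- c - x", unfolded nn_integral_set_ennreal] assms by (simp add: w_def mult_ac)
  have wint: "integrable lborel w"
    by (rule integrableI_nn_integral_finite[OF _ _ w]) (auto simp: w_def)
  have "Beta x (- c - x) \<ge> 0"
    using assms by (auto simp: Beta_def intro!: divide_nonneg_nonneg mult_nonneg_nonneg less_imp_le[OF Gamma_real_pos])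
  with w wint have weq: "integral\<^sup>L lborel w = Beta x (- c - x)"
    using nn_integral_eq_integral[OF wint] by (auto simp: w_def integral_nonneg_AE)
  have "(\<lambda>i. confluent_integral x c (X i)) \<longlonglongrightarrow> integral\<^sup>L lborel w"
    unfolding confluent_integral_def set_lebesgue_integral_def
  proof (rule integral_dominated_convergence[OF _ _ wint])
    show "AE t in lborel. (\<lambda>i. indicat_real {0<..} t *\<^sub>R (t powr (x - 1) * (1 + t) powr c * exp (- (X i * t)))) \<longlonglongrightarrow> w t"
    proof (rule AE_I2)
      fix t :: real
      have "(\<lambda>i. indicat_real {0<..} t *\<^sub>R (t powr (x - 1) * (1 + t) powr c * exp (- (X i * t)))) \<longlonglongrightarrow>
        indicat_real {0<..} t *\<^sub>R (t powr (x - 1) * (1 + t) powr c * exp (- (0 * t)))"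
        by (intro tendsto_intros X)
      then show "(\<lambda>i. indicat_real {0<..} t *\<^sub>R (t powr (x - 1) * (1 + t) powr c * exp (- (X i * t)))) \<longlonglongrightarrow> w t"
        by (simp add: w_def)
    qed
    show "AE t in lborel. norm (indicat_real {0<..} t *\<^sub>R (t powr (x - 1) * (1 + t) powr c * exp (- (X i * t)))) \<le> w t" for i
      using X(1) by (intro AE_I2) (auto simp: w_def abs_mult less_imp_le split: split_indicator intro!: mult_left_le)
  qed (auto simp: w_def[abs_def])
  then show "((confluent_integral x c) \<circ> X) \<longlonglongrightarrow> Beta x (- c - x)"
    by (simp add: o_def weq)
qed

text \<open>Integration of the derivative of \<open>t powr x * (1 + t) powr (c + 1) * exp (- (z * t))\<close>.\<close>

lemma confluent_integral_contiguous:
  assumes "x > 0" "z > 0"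
  shows "z * confluent_integral (x + 2) c z =
    (x + c + 1 - z) * confluent_integral (x + 1) c z + x * confluent_integral x c z"
proof -
  define F where "F t = t powr x * (1 + t) powr (c + 1) * exp (- (z * t))" for t
  define g where "g k t = t powr (x + k - 1) * (1 + t) powr c * exp (- (z * t))" for k t :: real
  \<comment> \<open>The derivative of \<open>F\<close>, expanded in powers of \<open>t\<close> so
    that each \<open>g k\<close> integrates to
    \<open>confluent_integral (x + k) c z\<close>.\<close>
  define f where "f t = x * g 0 t + (x + c + 1 - z) * g 1 t - z * g 2 t" for t
  have gint: "set_integrable lborel {0<..} (g k)" if "k \<ge> 0" for k
    unfolding g_def using assms that by (intro set_integrable_confluent) auto
  have gi: "(LBINT t:{0<..}. g k t) = confluent_integral (x + k) c z" for k
    by (simp add: g_def confluent_integral_def)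
  have fint: "set_integrable lborel {0<..} f"
    unfolding f_def by (intro set_integral_add set_integral_diff set_integrable_mult_right gint) auto
  have "(LBINT t=ereal 0..\<infinity>. f t) = 0 - 0"
  proof (rule interval_integral_FTC_integrable[where F = F])
    fix t :: real assume "ereal 0 < ereal t"
    then have t: "t > 0" by simp
    have "(F has_real_derivative
        (x * t powr (x - 1) * (1 + t) powr (c + 1) + t powr x * ((c + 1) * (1 + t) powr c)) * exp (- (z * t))
        - t powr x * (1 + t) powr (c + 1) * (z * exp (- (z * t)))) (at t)"
      unfolding F_def
      by (rule derivative_eq_intros refl | use t in simp)+
    moreover have "f t =
        (x * t powr (x - 1) * (1 + t) powr (c + 1) + t powr x * ((c + 1) * (1 + t) powr c)) * exp (- (z * t))
        - t powr x * (1 + t) powr (c + 1) * (z * exp (- (z * t)))"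
    proof -
      have p: "t powr x = t powr (x - 1) * t" "t powr (x + 1) = t powr (x - 1) * t * t"
        "(1 + t) powr (c + 1) = (1 + t) powr c * (1 + t)"
        using t powr_add[of t "x - 1" 1] powr_add[of t x 1] powr_add[of "1 + t" c 1] by simp_all
      have g: "g 0 t = t powr (x - 1) * (1 + t) powr c * exp (- (z * t))"
        "g 1 t = t powr (x - 1) * t * (1 + t) powr c * exp (- (z * t))"
        "g 2 t = t powr (x - 1) * t * t * (1 + t) powr c * exp (- (z * t))"
      proof -
        have "x + 0 - 1 = x - 1" "x + 1 - 1 = x" "x + 2 - 1 = x + 1" by simp_all
        then show "g 0 t = t powr (x - 1) * (1 + t) powr c * exp (- (z * t))"
          "g 1 t = t powr (x - 1) * t * (1 + t) powr c * exp (- (z * t))"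
          "g 2 t = t powr (x - 1) * t * t * (1 + t) powr c * exp (- (z * t))"
          unfolding g_def by (simp_all only: p)
      qed
      have "x * (u * v * e) + (x + c + 1 - z) * (u * t * v * e) - z * (u * t * t * v * e)
        = (x * u * (v * (1 + t)) + u * t * ((c + 1) * v)) * e - u * t * (v * (1 + t)) * (z * e)" for u v e
        by (simp add: algebra_simps)
      then show ?thesis unfolding f_def g p .
    qed
    ultimately have "(F has_real_derivative f t) (at t)" by simp
    then show "(F has_vector_derivative f t) (at t)"
      by (simp add: has_real_derivative_iff_has_vector_derivative)
    show "isCont f t"
      unfolding f_def g_def using t by (intro continuous_intros) auto
  next
    \<comment> \<open>The boundary values vanish: at 0 because \<open>x > 0\<close>, at infinity
      because \<open>z > 0\<close>.\<close>
    show "((F \<circ> real_of_ereal) \<longlongrightarrow> 0) (at_right (ereal 0))"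
      unfolding ereal_tendsto_simps1 F_def
      using assms by real_asymp
    show "((F \<circ> real_of_ereal) \<longlongrightarrow> 0) (at_left \<infinity>)"
      unfolding ereal_tendsto_simps1 F_def
      using assms by real_asymp
  qed (use fint in auto)
  then have "(LBINT t:{0<..}. f t) = 0"
    by (simp add: interval_integral_to_infinity_eq)
  moreover have "(LBINT t:{0<..}. f t) = x * confluent_integral x c z +
    (x + c + 1 - z) * confluent_integral (x + 1) c z - z * confluent_integral (x + 2) c z"
  proof -
    have i: "set_integrable lborel {0<..} (\<lambda>t. x * g 0 t)"
      "set_integrable lborel {0<..} (\<lambda>t. (x + c + 1 - z) * g 1 t)"
      "set_integrable lborel {0<..} (\<lambda>t. z * g 2 t)"
      by (intro set_integrable_mult_right gint; simp)+
    show ?thesis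
      unfolding f_def set_integral_diff(2)[OF set_integral_add(1)[OF i(1,2)] i(3)] set_integral_add(2)[OF i(1,2)]
      using gi[of 0] gi[of 1] gi[of 2] by simp
  qed
  ultimately show ?thesis by simp
qed

section \<open>Integral representation of the Tricomi function\<close>

text \<open>The complex reflection formula on the real line. At integers both sides are 0: one Gamma
  factor sits at a pole, where its value is 0, and the right side divides by 0.\<close>

lemma Gamma_reflection_real: "Gamma (y :: real) * Gamma (1 - y) = pi / sin (pi * y)"
proof -
  have "complex_of_real (Gamma y * Gamma (1 - y)) = complex_of_real (pi / sin (pi * y))"
    using Gamma_reflection_complex[of "complex_of_real y"]
    by (metis Gamma_complex_of_real of_real_1 of_real_diff of_real_divide of_real_mult sin_of_real)
  then show ?thesis by (simp only: of_real_eq_iff)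
qed

lemma Gamma_Suc_pos: "x > 0 \<Longrightarrow> Gamma (x + 1) = x * Gamma (x :: real)"
  by (rule Gamma_plus1) (auto elim!: nonpos_Ints_cases)

lemma Gamma_Suc_notin_Ints: "y \<notin> \<int> \<Longrightarrow> Gamma (y + 1) = y * Gamma (y :: real)"
  by (rule Gamma_plus1) (auto dest: nonpos_Ints_Int)

lemma minus_notin_Ints:
  fixes y :: real
  assumes "y \<notin> \<int>" "k \<in> \<int>"
  shows "k - y \<notin> \<int>"
  using assms Ints_diff[of k "k - y"] by auto

section \<open>Kummer's equation and Wronskians\<close>

text \<open>The function is constant on the half-line, and its limit at 0 determines the constant.
  This evaluates Wronskians and identifies functions with equal derivatives and limits.\<close>

lemma zero_derivative_imp_eq_limit:
  fixes f :: "real \<Rightarrow> real"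
  assumes "\<And>z. z > 0 \<Longrightarrow> (f has_real_derivative 0) (at z)"
    and "(f \<longlongrightarrow> L) (at_right 0)" and "z > 0"
  shows "f z = L"
proof -
  have "\<exists>c. \<forall>z\<in>{0<..}. f z = c"
    by (rule has_field_derivative_zero_constant) (auto intro: has_field_derivative_at_within assms(1))
  then obtain c where c: "\<And>z. z > 0 \<Longrightarrow> f z = c" by auto
  have "((\<lambda>_::real. c) \<longlongrightarrow> L) (at_right 0)"
    by (rule Lim_transform_eventually[OF assms(2)])
      (auto simp: eventually_at_right_field c intro: exI[of _ 1])
  then show ?thesis using c[OF assms(3)] by (simp add: tendsto_const_iff)
qed

text \<open>Kummer's equation \<open>z u'' + (y - z) u' = x u\<close> as a first-order system for \<open>u\<close> and
  \<open>v = z powr y * u'\<close>.\<close>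

definition kummer_system :: "real \<Rightarrow> real \<Rightarrow> (real \<Rightarrow> real) \<Rightarrow> (real \<Rightarrow> real) \<Rightarrow> bool" where
  "kummer_system x y u v \<longleftrightarrow> (\<forall>z>0. (u has_real_derivative z powr (- y) * v z) (at z) \<and>
     (v has_real_derivative v z + x * z powr (y - 1) * u z) (at z))"

text \<open>In the derivative of \<open>u1 z * v2 z - u2 z * v1 z\<close> the coupling terms cancel
  and the expression itself remains; the factor \<open>exp (- z)\<close> makes it constant.\<close>

lemma kummer_system_Wronskian:
  assumes "kummer_system x y u1 v1" "kummer_system x y u2 v2"
    and "(u1 \<longlongrightarrow> A1) (at_right 0)" "(v1 \<longlongrightarrow> B1) (at_right 0)"
    and "(u2 \<longlongrightarrow> A2) (at_right 0)" "(v2 \<longlongrightarrow> B2) (at_right 0)"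
    and "z > 0"
  shows "exp (- z) * (u1 z * v2 z - u2 z * v1 z) = A1 * B2 - A2 * B1"
proof (rule zero_derivative_imp_eq_limit[OF _ _ \<open>z > 0\<close>])
  have "((\<lambda>z. exp (- z) * (u1 z * v2 z - u2 z * v1 z)) \<longlongrightarrow> exp (- 0) * (A1 * B2 - A2 * B1)) (at_right 0)"
    by (intro tendsto_intros assms)
  then show "((\<lambda>z. exp (- z) * (u1 z * v2 z - u2 z * v1 z)) \<longlongrightarrow> A1 * B2 - A2 * B1) (at_right 0)" by simp
next
  fix z :: real assume z: "z > 0"
  have d: "(u1 has_real_derivative z powr (- y) * v1 z) (at z)"
    "(v1 has_real_derivative v1 z + x * z powr (y - 1) * u1 z) (at z)"
    "(u2 has_real_derivative z powr (- y) * v2 z) (at z)"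
    "(v2 has_real_derivative v2 z + x * z powr (y - 1) * u2 z) (at z)"
    using assms(1,2) z by (auto simp: kummer_system_def)
  show "((\<lambda>z. exp (- z) * (u1 z * v2 z - u2 z * v1 z)) has_real_derivative 0) (at z)"
    by (rule derivative_eq_intros d refl)+ (simp add: algebra_simps)
qed

text \<open>The solution regular at 0; its second equation is
  \<open>powr_Kummer_M_has_derivative\<close> rewritten by the right contiguous relation.\<close>

lemma kummer_system_M:
  assumes "y \<notin> \<int>"
  shows "kummer_system x y (Kummer_M x y) (\<lambda>z. x / y * (z powr y * Kummer_M (x + 1) (y + 1) z))"
  unfolding kummer_system_def
proof (intro allI impI conjI)
  fix z :: real assume z: "z > 0"
  have "z powr (- y) * (x / y * (z powr y * Kummer_M (x + 1) (y + 1) z)) = x / y * Kummer_M (x + 1) (y + 1) z"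
    using z by (simp add: powr_minus)
  then show "(Kummer_M x y has_real_derivative z powr (- y) * (x / y * (z powr y * Kummer_M (x + 1) (y + 1) z))) (at z)"
    using Kummer_M_has_derivative[OF assms] by (simp only:)
  have "x / y * (y * z powr (y - 1) * Kummer_M (x + 1) y z) =
    x / y * (z powr y * Kummer_M (x + 1) (y + 1) z) + x * z powr (y - 1) * Kummer_M x y z"
  proof -
    have "z powr y = z powr (y - 1) * z" using z by (simp add: powr_diff)
    moreover have "y \<noteq> 0" using assms by auto
    ultimately show ?thesis
      unfolding Kummer_M_contiguous_right[OF assms, symmetric, of x] by (simp add: field_simps)
  qed
  then show "((\<lambda>z. x / y * (z powr y * Kummer_M (x + 1) (y + 1) z)) has_real_derivative
      x / y * (z powr y * Kummer_M (x + 1) (y + 1) z) + x * z powr (y - 1) * Kummer_M x y z) (at z)"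
    using DERIV_cmult[OF powr_Kummer_M_has_derivative[OF assms z, of "x + 1"], of "x / y"] by simp
qed

text \<open>The second solution. Its power prefactor disappears from \<open>v\<close>, and the left
  contiguous relation at \<open>1 + x - y\<close>, \<open>2 - y\<close> gives the derivative of
  \<open>v\<close>.\<close>

lemma kummer_system_powr_M:
  assumes "y \<notin> \<int>"
  shows "kummer_system x y (\<lambda>z. z powr (1 - y) * Kummer_M (1 + x - y) (2 - y) z)
    (\<lambda>z. (1 - y) * Kummer_M (1 + x - y) (1 - y) z)"
  unfolding kummer_system_def
proof (intro allI impI conjI)
  fix z :: real assume z: "z > 0"
  have y: "1 - y \<notin> \<int>" "2 - y \<notin> \<int>"
    using minus_notin_Ints[OF assms] by auto
  show "((\<lambda>z. z powr (1 - y) * Kummer_M (1 + x - y) (2 - y) z) has_real_derivative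
      z powr (- y) * ((1 - y) * Kummer_M (1 + x - y) (1 - y) z)) (at z)"
    using powr_Kummer_M_has_derivative[OF y(1) z, of "1 + x - y"] by (simp add: mult_ac)
  have "(1 - y) * ((1 + x - y) / (1 - y) * Kummer_M (1 + x - y + 1) (1 - y + 1) z) =
    (1 - y) * Kummer_M (1 + x - y) (1 - y) z +
    x * z powr (y - 1) * (z powr (1 - y) * Kummer_M (1 + x - y) (2 - y) z)"
  proof -
    have e: "1 + x - y - (2 - y) + 1 = x" "2 - y - 1 = 1 - y" "1 - y + 1 = 2 - y" by simp_all
    have p: "x * z powr (y - 1) * (z powr (1 - y) * K) = x * K" for K
    proof -
      have "z powr (y - 1) * z powr (1 - y) = 1" using z by (simp flip: powr_add)
      then show ?thesis by (metis mult.assoc mult_1_right)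
    qed
    have "1 - y \<noteq> 0" using y by (metis Ints_0)
    then have "(1 - y) * ((1 + x - y) / (1 - y) * K) = (1 + x - y) * K" for K by simp
    then show ?thesis
      using Kummer_M_contiguous_left[OF y(2), of "1 + x - y" z] unfolding e p by simp
  qed
  then show "((\<lambda>z. (1 - y) * Kummer_M (1 + x - y) (1 - y) z) has_real_derivative
      (1 - y) * Kummer_M (1 + x - y) (1 - y) z +
      x * z powr (y - 1) * (z powr (1 - y) * Kummer_M (1 + x - y) (2 - y) z)) (at z)"
    using DERIV_cmult[OF Kummer_M_has_derivative[OF y(1), of "1 + x - y" z], of "1 - y"] by simp
qed

text \<open>The second derivative of the integral brings in parameter \<open>x + 2\<close>, which
  \<open>confluent_integral_contiguous\<close> eliminates.\<close>

lemma kummer_system_integral: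
  assumes "x > 0"
  shows "kummer_system x y (confluent_integral x (y - x - 1))
    (\<lambda>z. - (z powr y * confluent_integral (x + 1) (y - x - 1) z))"
  unfolding kummer_system_def
proof (intro allI impI conjI)
  fix z :: real assume z: "z > 0"
  define c where "c = y - x - 1"
  have "z powr (- y) * - (z powr y * confluent_integral (x + 1) c z) = - confluent_integral (x + 1) c z"
    using z by (simp add: powr_minus)
  then show "(confluent_integral x (y - x - 1) has_real_derivative
      z powr (- y) * - (z powr y * confluent_integral (x + 1) (y - x - 1) z)) (at z)"
    using confluent_integral_has_derivative[OF assms z, of c] unfolding c_def by (simp only:)
  have d: "(confluent_integral (x + 1) c has_real_derivative - confluent_integral (x + 1 + 1) c z) (at z)"
    by (rule confluent_integral_has_derivative) (use assms z in auto)
  have "((\<lambda>z. - (z powr y * confluent_integral (x + 1) c z)) has_real_derivative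
      - (y * z powr (y - 1) * confluent_integral (x + 1) c z - confluent_integral (x + 1 + 1) c z * z powr y)) (at z)"
    by (rule derivative_eq_intros d refl z)+ simp
  moreover have "- (y * z powr (y - 1) * confluent_integral (x + 1) c z - confluent_integral (x + 1 + 1) c z * z powr y)
      = - (z powr y * confluent_integral (x + 1) c z) + x * z powr (y - 1) * confluent_integral x c z"
  proof -
    have p: "z powr y = z powr (y - 1) * z" using z by (simp add: powr_diff)
    have "x + 1 + 1 = x + 2" "x + c + 1 = y" by (simp_all add: c_def)
    then have "z * confluent_integral (x + 1 + 1) c z =
        (y - z) * confluent_integral (x + 1) c z + x * confluent_integral x c z"
      using confluent_integral_contiguous[OF assms z, of c] by (simp only:)
    then show ?thesis unfolding p by algebra
  qed
  ultimately show "((\<lambda>z. - (z powr y * confluent_integral (x + 1) (y - x - 1) z)) has_real_derivative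
      - (z powr y * confluent_integral (x + 1) (y - x - 1) z) +
      x * z powr (y - 1) * confluent_integral x (y - x - 1) z) (at z)"
    unfolding c_def by simp
qed

section \<open>Limits at 0 and the case \<open>0 < y < 1\<close>\<close>

lemma tendsto_powr_at_right_0:
  fixes s :: real
  assumes "s > 0"
  shows "((\<lambda>z. z powr s) \<longlongrightarrow> 0) (at_right 0)"
  using assms by real_asymp

lemma tendsto_Kummer_M_at_right_0:
  assumes "y \<notin> \<int>"
  shows "(Kummer_M x y \<longlongrightarrow> 1) (at_right 0)"
  using isCont_Kummer_M[OF assms, of 0 x]
  by (simp add: isCont_def Kummer_M_0 filterlim_at_split)

lemma powr_Kummer_M_at_0:
  fixes y :: real
  assumes "y \<notin> \<int>" "s > 0"
  shows "((\<lambda>z. z powr s * Kummer_M x y z) \<longlongrightarrow> 0) (at_right 0)"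
  using tendsto_mult[OF tendsto_powr_at_right_0[OF assms(2)] tendsto_Kummer_M_at_right_0[OF assms(1)]]
  by simp

text \<open>All coefficients are read off from the limits of the Wronskians at 0, which exist for
  \<open>0 < y < 1\<close> only.\<close>

lemma Tricomi_Psi_integral_base:
  assumes "x > 0" "0 < y" "y < 1" "z > 0"
  shows "Tricomi_Psi x y z = confluent_integral x (y - x - 1) z / Gamma x"
proof -
  define c where "c = 1 + x - y"
  have c: "c > 0" "y - x - 1 = - c" using assms by (auto simp: c_def)
  have yZ: "y \<notin> \<int>"
  proof
    assume "y \<in> \<int>"
    then obtain n where "y = of_int n" by (auto elim: Ints_cases)
    then show False using assms by auto
  qed
  have y1Z: "y + 1 \<notin> \<int>" using yZ by simp
  have y2Z: "1 - y \<notin> \<int>" "2 - y \<notin> \<int>" using minus_notin_Ints[OF yZ] by auto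
  have G: "Gamma x > 0" "Gamma c > 0" "Gamma y > 0" "Gamma (1 - y) > 0" "Gamma (x + 1) > 0"
    using assms c by (auto intro: Gamma_real_pos)
  define J where "J = confluent_integral x (y - x - 1)"
  define vJ where "vJ z = - (z powr y * confluent_integral (x + 1) (y - x - 1) z)" for z
  define w1 where "w1 = Kummer_M x y"
  define v1 where "v1 z = x / y * (z powr y * Kummer_M (x + 1) (y + 1) z)" for z
  define w2 where "w2 z = z powr (1 - y) * Kummer_M (1 + x - y) (2 - y) z" for z
  define v2 where "v2 z = (1 - y) * Kummer_M (1 + x - y) (1 - y) z" for z
  have sys: "kummer_system x y J vJ" "kummer_system x y w1 v1" "kummer_system x y w2 v2"
    using kummer_system_integral[OF assms(1), of y] kummer_system_M[OF yZ, of x] kummer_system_powr_M[OF yZ, of x]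
    by (simp_all add: J_def vJ_def[abs_def] w1_def v1_def[abs_def] w2_def[abs_def] v2_def[abs_def])
  have "(J \<longlongrightarrow> Beta x (- (y - x - 1) - x)) (at_right 0)"
    unfolding J_def by (rule confluent_integral_at_0) (use assms in auto)
  then have lJ: "(J \<longlongrightarrow> Gamma x * Gamma (1 - y) / Gamma c) (at_right 0)"
    by (simp add: Beta_def c_def algebra_simps)
  \<comment> \<open>The integral with parameter \<open>x + 1\<close> diverges at 0 like
    \<open>z powr (- y)\<close>. Kummer's transformation extracts this power, and the remaining
    integral has a Beta limit.\<close>
  have lvJ: "(vJ \<longlongrightarrow> - Gamma y) (at_right 0)"
  proof (rule Lim_transform_eventually)
    have "(confluent_integral c (- (x + 1)) \<longlongrightarrow> Beta c (- (- (x + 1)) - c)) (at_right 0)"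
      by (rule confluent_integral_at_0) (use c assms in \<open>auto simp: c_def\<close>)
    also have "Beta c (- (- (x + 1)) - c) = Gamma c * Gamma y / Gamma (x + 1)"
      by (simp add: Beta_def c_def algebra_simps)
    finally have "((\<lambda>z. - (Gamma (x + 1) / Gamma c * confluent_integral c (- (x + 1)) z)) \<longlongrightarrow>
        - (Gamma (x + 1) / Gamma c * (Gamma c * Gamma y / Gamma (x + 1)))) (at_right 0)"
      by (intro tendsto_intros)
    also have "- (Gamma (x + 1) / Gamma c * (Gamma c * Gamma y / Gamma (x + 1))) = - Gamma y"
      using G by simp
    finally show "((\<lambda>z. - (Gamma (x + 1) / Gamma c * confluent_integral c (- (x + 1)) z)) \<longlongrightarrow> - Gamma y) (at_right 0)" .
    show "eventually (\<lambda>z. - (Gamma (x + 1) / Gamma c * confluent_integral c (- (x + 1)) z) = vJ z) (at_right 0)"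
      unfolding eventually_at_right_field
    proof (intro exI[of _ 1] conjI allI impI)
      fix z :: real assume z: "z > 0"
      have "c - (x + 1) = - y" by (simp add: c_def)
      then have "confluent_integral (x + 1) (- c) z = Gamma (x + 1) / Gamma c * z powr (- y) * confluent_integral c (- (x + 1)) z"
        using confluent_integral_Kummer[of "x + 1" c z] assms c z by (simp only:)
      then show "- (Gamma (x + 1) / Gamma c * confluent_integral c (- (x + 1)) z) = vJ z"
        using z by (simp add: vJ_def c(2) powr_minus)
    qed simp
  qed
  have l1: "(w1 \<longlongrightarrow> 1) (at_right 0)"
    unfolding w1_def by (rule tendsto_Kummer_M_at_right_0[OF yZ])
  have lv1: "(v1 \<longlongrightarrow> 0) (at_right 0)"
    using tendsto_mult[OF tendsto_const[of "x / y"] powr_Kummer_M_at_0[OF y1Z assms(2), of "x + 1"]]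
    by (simp add: v1_def[abs_def])
  have l2: "(w2 \<longlongrightarrow> 0) (at_right 0)"
    using powr_Kummer_M_at_0[OF y2Z(2), of "1 - y" "1 + x - y"] assms by (simp add: w2_def[abs_def])
  have lv2: "(v2 \<longlongrightarrow> 1 - y) (at_right 0)"
    using tendsto_mult[OF tendsto_const[of "1 - y"] tendsto_Kummer_M_at_right_0[OF y2Z(1), of "1 + x - y"]]
    by (simp add: v2_def[abs_def])
  have W: "exp (- z) * (w1 z * v2 z - w2 z * v1 z) = 1 - y"
    "exp (- z) * (J z * v2 z - w2 z * vJ z) = Gamma x * Gamma (1 - y) / Gamma c * (1 - y)"
    "exp (- z) * (J z * v1 z - w1 z * vJ z) = Gamma y"
    using kummer_system_Wronskian[OF sys(2,3) l1 lv1 l2 lv2 assms(4)]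
      kummer_system_Wronskian[OF sys(1,3) lJ lvJ l2 lv2 assms(4)]
      kummer_system_Wronskian[OF sys(1,2) lJ lvJ l1 lv1 assms(4)] by auto
  \<comment> \<open>An identity between three solutions: it eliminates the \<open>v\<close>
    components and writes \<open>J\<close> in terms of \<open>w1\<close> and \<open>w2\<close>, with
    Wronskians as coefficients.\<close>
  have "J z * (exp (- z) * (w1 z * v2 z - w2 z * v1 z)) =
      w1 z * (exp (- z) * (J z * v2 z - w2 z * vJ z)) - w2 z * (exp (- z) * (J z * v1 z - w1 z * vJ z))"
    by algebra
  then have "J z * (1 - y) = w1 z * (Gamma x * Gamma (1 - y) / Gamma c * (1 - y)) - w2 z * Gamma y"
    unfolding W .
  then have "J z = w1 z * (Gamma x * Gamma (1 - y) / Gamma c) - w2 z * Gamma y / (1 - y)"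
    using assms by (simp add: field_simps)
  moreover have "Gamma (2 - y) = (1 - y) * Gamma (1 - y)"
    using Gamma_Suc_notin_Ints[OF y2Z(1)] by (simp add: add_ac)
  moreover have "Gamma y * Gamma (1 - y) * (w1 z / (Gamma c * Gamma y) - w2 z / (Gamma x * ((1 - y) * Gamma (1 - y)))) =
      (w1 z * (Gamma x * Gamma (1 - y) / Gamma c) - w2 z * Gamma y / (1 - y)) / Gamma x"
  proof -
    have "gy * g1 * (m1 / (gc * gy) - m2 / (gx * (d * g1))) = (m1 * (gx * g1 / gc) - m2 * gy / d) / gx"
      if "gc > 0" "gx > 0" "gy > 0" "g1 > 0" "d > 0" for gx gc gy g1 d m1 m2 :: real
      using that by (simp add: field_simps)
    then show ?thesis using G assms(3) by simp
  qed
  ultimately show ?thesis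
    unfolding Tricomi_Psi_def Gamma_reflection_real[symmetric] J_def[symmetric]
      w1_def[symmetric] w2_def[symmetric]
    unfolding c_def[symmetric] by (simp only:)
qed

section \<open>Extension to all non-integer second parameters\<close>

text \<open>Raising \<open>x\<close> and \<open>y\<close> together leaves \<open>1 + x - y\<close>
  fixed and flips the sign of the sine; the Gamma recurrences match the remaining factors.\<close>

lemma Tricomi_Psi_has_derivative:
  assumes "y \<notin> \<int>" "x > 0" "1 + x - y > 0" "z > 0"
  shows "(Tricomi_Psi x y has_real_derivative - x * Tricomi_Psi (x + 1) (y + 1) z) (at z)"
proof -
  define s where "s = pi / sin (pi * y)"
  have y2Z: "1 - y \<notin> \<int>" using minus_notin_Ints[OF assms(1)] by auto
  have y0: "y \<noteq> 0" "1 - y \<noteq> 0" using assms(1) y2Z by (metis Ints_0)+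
  have G: "Gamma y \<noteq> 0" "Gamma (1 - y) \<noteq> 0" "Gamma x \<noteq> 0"
    using assms(1,2) y2Z by (auto simp: Gamma_eq_zero_iff dest: nonpos_Ints_Int)
  have Gp: "Gamma (y + 1) = y * Gamma y" "Gamma (2 - y) = (1 - y) * Gamma (1 - y)" "Gamma (x + 1) = x * Gamma x"
    using Gamma_Suc_notin_Ints[OF y2Z] Gamma_Suc_notin_Ints[OF assms(1)] Gamma_Suc_pos[OF assms(2)]
    by (auto simp: add_ac)
  have s': "pi / sin (pi * (y + 1)) = - s"
    by (simp add: s_def ring_distribs sin_add)
  have d1: "(Kummer_M x y has_real_derivative x / y * Kummer_M (x + 1) (y + 1) z) (at z)"
    by (rule Kummer_M_has_derivative[OF assms(1)])
  have d2: "((\<lambda>z. z powr (1 - y) * Kummer_M (1 + x - y) (2 - y) z) has_real_derivative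
      (1 - y) * z powr (- y) * Kummer_M (1 + x - y) (1 - y) z) (at z)"
    using powr_Kummer_M_has_derivative[OF y2Z assms(4), of "1 + x - y"] by simp
  have "((\<lambda>z. s * (Kummer_M x y z / (Gamma (1 + x - y) * Gamma y) -
      z powr (1 - y) * Kummer_M (1 + x - y) (2 - y) z / (Gamma x * Gamma (2 - y)))) has_real_derivative
      s * (x / y * Kummer_M (x + 1) (y + 1) z / (Gamma (1 + x - y) * Gamma y) -
      (1 - y) * z powr (- y) * Kummer_M (1 + x - y) (1 - y) z / (Gamma x * Gamma (2 - y)))) (at z)"
    by (intro DERIV_cmult DERIV_diff DERIV_cdivide d1 d2)
  moreover have "- x * Tricomi_Psi (x + 1) (y + 1) z =
      s * (x / y * Kummer_M (x + 1) (y + 1) z / (Gamma (1 + x - y) * Gamma y) -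
      (1 - y) * z powr (- y) * Kummer_M (1 + x - y) (1 - y) z / (Gamma x * Gamma (2 - y)))"
  proof -
    have e: "1 + (x + 1) - (y + 1) = 1 + x - y" "1 - (y + 1) = - y" "2 - (y + 1) = 1 - y" by simp_all
    have k: "- x * (- s * (M1 / (g * (y * gy)) - p * M2 / (x * gx * g1))) =
        s * (x / y * M1 / (g * gy) - (1 - y) * p * M2 / (gx * ((1 - y) * g1)))" for M1 M2 p g gy gx g1
      using y0 assms(2) by (simp add: divide_simps)
    show ?thesis
      unfolding Tricomi_Psi_def e s' Gp by (rule k)
  qed
  ultimately show ?thesis
    unfolding Tricomi_Psi_def[abs_def] s_def by simp
qed

text \<open>For \<open>y < 1\<close> the second summand carries a positive power of \<open>z\<close>
  and vanishes; the reflection formula simplifies the constant left by the first.\<close>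

lemma Tricomi_Psi_at_0:
  assumes "y \<notin> \<int>" "y < 1"
  shows "(Tricomi_Psi x y \<longlongrightarrow> Gamma (1 - y) / Gamma (1 + x - y)) (at_right 0)"
proof -
  have y2Z: "2 - y \<notin> \<int>" using minus_notin_Ints[OF assms(1)] by auto
  have G: "Gamma y \<noteq> 0" using assms(1) by (auto simp: Gamma_eq_zero_iff dest: nonpos_Ints_Int)
  have "(Tricomi_Psi x y \<longlongrightarrow> pi / sin (pi * y) * (1 / (Gamma (1 + x - y) * Gamma y) - 0 / (Gamma x * Gamma (2 - y)))) (at_right 0)"
    unfolding Tricomi_Psi_def[abs_def]
    using powr_Kummer_M_at_0[OF y2Z, of "1 - y" "1 + x - y"] tendsto_Kummer_M_at_right_0[OF assms(1), of x] assms(2)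
    by (intro tendsto_mult tendsto_diff tendsto_divide_zero tendsto_const)
       (auto intro: tendsto_eq_intros simp: divide_inverse intro!: tendsto_mult_right)
  then show ?thesis using G by (simp flip: Gamma_reflection_real)
qed

text \<open>For \<open>y < 1\<close> both sides have the same limit at 0, so the identity for \<open>(x + 1, y + 1)\<close>
  integrates to the one for \<open>(x, y)\<close>.\<close>

lemma Tricomi_Psi_integral_less_1:
  assumes "- real n < y" "y < 1 - real n" "x > 0" "z > 0"
  shows "Tricomi_Psi x y z = confluent_integral x (y - x - 1) z / Gamma x"
  using assms
proof (induction n arbitrary: x y z)
  case 0
  then show ?case by (intro Tricomi_Psi_integral_base) auto
next
  case (Suc n)
  have yZ: "y \<notin> \<int>"
  proof
    assume "y \<in> \<int>"
    then obtain m where "y = of_int m" by (auto elim: Ints_cases)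
    then have "- int (Suc n) < m" "m < 1 - int (Suc n)" using Suc.prems(1,2) by linarith+
    then show False by simp
  qed
  have y1: "y < 1" using Suc.prems by simp
  have c: "1 + x - y > 0" using y1 Suc.prems by simp
  have Gx: "Gamma x > 0" "Gamma (x + 1) = x * Gamma x"
    using Suc.prems Gamma_Suc_pos[of x] by (auto intro: Gamma_real_pos)
  have "Tricomi_Psi x y z - confluent_integral x (y - x - 1) z / Gamma x = 0"
  proof (rule zero_derivative_imp_eq_limit[OF _ _ \<open>z > 0\<close>])
    fix z :: real assume z: "z > 0"
    \<comment> \<open>The shift moves \<open>y\<close> into the strip of index \<open>n\<close> and
      keeps the exponent \<open>y - x - 1\<close>.\<close>
    have "Tricomi_Psi (x + 1) (y + 1) z = confluent_integral (x + 1) (y - x - 1) z / Gamma (x + 1)"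
      using Suc.IH[of "y + 1" "x + 1" z] Suc.prems z by simp
    then show "((\<lambda>z. Tricomi_Psi x y z - confluent_integral x (y - x - 1) z / Gamma x) has_real_derivative 0) (at z)"
      using DERIV_diff[OF Tricomi_Psi_has_derivative[OF yZ \<open>x > 0\<close> c z]
          DERIV_cdivide[OF confluent_integral_has_derivative[OF \<open>x > 0\<close> z, of "y - x - 1"], of "Gamma x"]] Gx
        \<open>x > 0\<close>
      by simp
  next
    have "Beta x (- (y - x - 1) - x) / Gamma x = Gamma (1 - y) / Gamma (1 + x - y)"
      using Gx by (simp add: Beta_def algebra_simps)
    then show "((\<lambda>z. Tricomi_Psi x y z - confluent_integral x (y - x - 1) z / Gamma x) \<longlongrightarrow> 0) (at_right 0)"
      using tendsto_diff[OF Tricomi_Psi_at_0[OF yZ y1, of x]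
          tendsto_divide[OF confluent_integral_at_0[OF \<open>x > 0\<close>, of "y - x - 1"] tendsto_const[of "Gamma x"]]]
        y1 Gx by simp
  qed
  then show ?case by simp
qed

text \<open>The map from \<open>(x, y)\<close> to \<open>(1 + x - y, 2 - y)\<close> exchanges the
  two Kummer terms, and the sign change of the sine restores their order.\<close>

lemma Tricomi_Psi_Kummer:
  assumes "z > 0"
  shows "Tricomi_Psi x y z = z powr (1 - y) * Tricomi_Psi (1 + x - y) (2 - y) z"
proof -
  have e: "1 + (1 + x - y) - (2 - y) = x" "1 - (2 - y) = y - 1" "2 - (2 - y) = y" by simp_all
  have s: "pi / sin (pi * (2 - y)) = - (pi / sin (pi * y))"
    by (simp add: right_diff_distrib sin_diff)
  have p: "z powr (1 - y) * z powr (y - 1) = 1" using assms by (simp flip: powr_add)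
  have "r * (- k * (N / (gx * g2) - q * M / (g1 * gy))) = k * (r * q * M / (g1 * gy) - r * N / (gx * g2))"
    for k M N g1 g2 gx gy r q :: real
    by (simp add: algebra_simps)
  then show ?thesis
    unfolding Tricomi_Psi_def e s by (simp only: p mult_1)
qed

theorem Tricomi_Psi_integral:
  assumes "y \<notin> \<int>" "x > 0" "1 + x - y > 0" "z > 0"
  shows "Tricomi_Psi x y z = confluent_integral x (y - x - 1) z / Gamma x"
proof -
  have less_1: "Tricomi_Psi x y z = confluent_integral x (y - x - 1) z / Gamma x"
    if "y < 1" "y \<notin> \<int>" "x > 0" for x y
  proof -
    \<comment> \<open>As \<open>y\<close> is not an integer, it lies strictly between
      \<open>m\<close> and \<open>m + 1\<close>; \<open>y < 1\<close> makes \<open>- m\<close> a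
      natural number, the index of the strip.\<close>
    define m n where "m = \<lfloor>y\<rfloor>" and "n = nat (- m)"
    have m: "of_int m < y" "y < of_int m + 1"
      using that(2) unfolding m_def by (metis Ints_of_int floor_correct order_le_less, linarith)
    then have "m < 1" using that(1) by linarith
    then have "real n = - of_int m" unfolding n_def by simp
    then show ?thesis
      by (intro Tricomi_Psi_integral_less_1[of n]) (use m that assms in auto)
  qed
  have "y \<noteq> 1" using assms(1) by auto
  then consider "y < 1" | "y > 1" by linarith
  then show ?thesis
  proof cases
    case 1
    then show ?thesis using less_1 assms by auto
  next
    \<comment> \<open>Now \<open>2 - y < 1\<close>, and both sides obey Kummer's transformation,
      which reduces this case to the previous one.\<close>
    case 2
    define c where "c = 1 + x - y"
    have c: "c > 0" "y - x - 1 = - c" "2 - y - c - 1 = - x" "c - x = 1 - y" using assms by (auto simp: c_def)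
    have G: "Gamma x > 0" "Gamma c > 0" using c assms by (auto intro: Gamma_real_pos)
    have "Tricomi_Psi x y z = z powr (1 - y) * Tricomi_Psi c (2 - y) z"
      unfolding c_def by (rule Tricomi_Psi_Kummer[OF assms(4)])
    also have "Tricomi_Psi c (2 - y) z = confluent_integral c (- x) z / Gamma c"
      using less_1[of "2 - y" c] 2 c minus_notin_Ints[OF assms(1), of 2] by simp
    also have "z powr (1 - y) * \<dots> = confluent_integral x (- c) z / Gamma x"
      using confluent_integral_Kummer[OF assms(2) c(1) assms(4)] G c by simp
    finally show ?thesis by (simp add: c)
  qed
qed

section \<open>Moments and antiderivatives\<close>

text \<open>With the order of integration exchanged, the inner integral over \<open>\<theta>\<close>
  is a generalised Gamma integral with \<open>A = \<kappa> * t\<close>. It contributes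
  \<open>t powr (- (s / q))\<close>, and a Beta integral remains.\<close>

lemma nn_integral_confluent_moment:
  assumes "s > 0" "q > 0" "\<kappa> > 0" "x - s / q > 0" "c - (x - s / q) > 0"
  shows "(\<integral>\<^sup>+\<theta>\<in>{0<..}. ennreal (\<theta> powr (s - 1) * confluent_integral x (- c) (\<kappa> * \<theta> powr q)) \<partial>lborel)
    = ennreal (Gamma (s / q) / (q * \<kappa> powr (s / q)) * Beta (x - s / q) (c - (x - s / q)))"
proof -
  have x: "x > 0" using assms(4) divide_pos_pos[OF assms(1,2)] by linarith
  define K where "K \<theta> t = ennreal (indicator {0<..} \<theta> * indicator {0<..} t *
    (\<theta> powr (s - 1) * (t powr (x - 1) * (1 + t) powr (- c) * exp (- (\<kappa> * \<theta> powr q * t)))))" for \<theta> t :: real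
  define D where "D = Gamma (s / q) / (q * \<kappa> powr (s / q))"
  have D: "D \<ge> 0" unfolding D_def using assms by (auto intro!: divide_nonneg_nonneg less_imp_le[OF Gamma_real_pos])
  have "(\<integral>\<^sup>+\<theta>\<in>{0<..}. ennreal (\<theta> powr (s - 1) * confluent_integral x (- c) (\<kappa> * \<theta> powr q)) \<partial>lborel)
    = (\<integral>\<^sup>+\<theta>. \<integral>\<^sup>+t. K \<theta> t \<partial>lborel \<partial>lborel)"
  proof (rule nn_integral_cong)
    fix \<theta> :: real
    show "ennreal (\<theta> powr (s - 1) * confluent_integral x (- c) (\<kappa> * \<theta> powr q)) * indicator {0<..} \<theta> = (\<integral>\<^sup>+t. K \<theta> t \<partial>lborel)"
    proof (cases "\<theta> > 0")
      case True
      then have z: "\<kappa> * \<theta> powr q > 0" using assms by simp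
      have "(\<integral>\<^sup>+t. K \<theta> t \<partial>lborel) = (\<integral>\<^sup>+t. ennreal (\<theta> powr (s - 1)) *
          (ennreal (t powr (x - 1) * (1 + t) powr (- c) * exp (- (\<kappa> * \<theta> powr q * t))) * indicator {0<..} t) \<partial>lborel)"
        using True by (intro nn_integral_cong) (auto simp: K_def ennreal_mult[symmetric] split: split_indicator)
      also have "\<dots> = ennreal (\<theta> powr (s - 1)) * ennreal (confluent_integral x (- c) (\<kappa> * \<theta> powr q))"
        by (subst nn_integral_cmult) (auto simp: nn_integral_confluent[OF x z])
      finally show ?thesis using True by (simp add: ennreal_mult confluent_integral_nonneg)
    qed (simp add: K_def)
  qed
  also have "\<dots> = (\<integral>\<^sup>+t. \<integral>\<^sup>+\<theta>. K \<theta> t \<partial>lborel \<partial>lborel)"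
    by (rule lborel_pair.Fubini') (unfold K_def case_prod_beta, measurable)
  also have "\<dots> = (\<integral>\<^sup>+t. ennreal D * (ennreal (t powr (x - s / q - 1) * (1 + t) powr (- c)) * indicator {0<..} t) \<partial>lborel)"
  proof (rule nn_integral_cong)
    fix t :: real
    show "(\<integral>\<^sup>+\<theta>. K \<theta> t \<partial>lborel) = ennreal D * (ennreal (t powr (x - s / q - 1) * (1 + t) powr (- c)) * indicator {0<..} t)"
    proof (cases "t > 0")
      case True
      have "(\<integral>\<^sup>+\<theta>. K \<theta> t \<partial>lborel) = (\<integral>\<^sup>+\<theta>. ennreal (t powr (x - 1) * (1 + t) powr (- c)) *
          (ennreal (\<theta> powr (s - 1) * exp (- ((\<kappa> * t) * \<theta> powr q))) * indicator {0<..} \<theta>) \<partial>lborel)"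
        using True by (intro nn_integral_cong) (auto simp: K_def ennreal_mult[symmetric] mult_ac split: split_indicator)
      also have "\<dots> = ennreal (t powr (x - 1) * (1 + t) powr (- c)) * ennreal (Gamma (s / q) / (q * (\<kappa> * t) powr (s / q)))"
        using assms True by (subst nn_integral_cmult) (auto simp: nn_integral_generalised_Gamma)
      also have "\<dots> = ennreal (t powr (x - 1) * (1 + t) powr (- c) * (Gamma (s / q) / (q * (\<kappa> * t) powr (s / q))))"
        by (rule ennreal_mult'[symmetric]) simp
      also have "t powr (x - 1) * (1 + t) powr (- c) * (Gamma (s / q) / (q * (\<kappa> * t) powr (s / q)))
          = D * (t powr (x - s / q - 1) * (1 + t) powr (- c))"
      proof -
        have "t powr (x - s / q - 1) = t powr (x - 1) / t powr (s / q)"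
          by (simp flip: powr_diff add: algebra_simps)
        then show ?thesis using assms True by (simp add: D_def powr_mult mult_ac)
      qed
      finally show ?thesis using True D by (simp add: ennreal_mult')
    qed (simp add: K_def)
  qed
  also have "\<dots> = ennreal D * ennreal (Beta (x - s / q) (c - (x - s / q)))"
    using nn_integral_Beta[OF assms(4,5)] by (subst nn_integral_cmult) auto
  also have "\<dots> = ennreal (D * Beta (x - s / q) (c - (x - s / q)))"
    using D by (rule ennreal_mult'[symmetric])
  finally show ?thesis by (simp add: D_def)
qed

lemma borel_measurable_confluent_integral [measurable]:
  "confluent_integral x c \<in> borel_measurable borel"
proof -
  have "(\<lambda>z. LINT t|lborel. indicator {0<..} t *\<^sub>R (t powr (x - 1) * (1 + t) powr c * exp (- (z * t)))) \<in> borel_measurable borel"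
    by (rule lborel.borel_measurable_lebesgue_integral) simp
  then show ?thesis
    by (simp add: confluent_integral_def[abs_def] set_lebesgue_integral_def)
qed

section \<open>Hypergeometric antiderivatives of Kummer's series\<close>

text \<open>The quotient of \<open>pochhammer s n\<close> by \<open>pochhammer (s + 1) n\<close>
  telescopes to \<open>s / (s + n)\<close>, the factor that integration of
  \<open>z powr (s + n - 1)\<close> produces.\<close>

lemma hypergeo_2F2_conv_kummer_coeff:
  assumes "s > 0"
  shows "hypergeo_2F2 \<alpha> s \<beta> (s + 1) z = (\<Sum>n. s / (s + real n) * kummer_coeff \<alpha> \<beta> n * z ^ n)"
proof -
  have "(pochhammer \<alpha> n * pochhammer s n) / (pochhammer \<beta> n * pochhammer (s + 1) n) * z ^ n / fact n
      = s / (s + real n) * kummer_coeff \<alpha> \<beta> n * z ^ n" for n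
  proof -
    have "pochhammer s n / pochhammer (s + 1) n = s / (s + real n)"
      using pochhammer_rec[of s n] pochhammer_Suc[of s n] assms pochhammer_pos[of "s + 1" n]
      by (simp add: divide_simps mult_ac)
    then have "s / (s + real n) * kummer_coeff \<alpha> \<beta> n * z ^ n
        = pochhammer s n / pochhammer (s + 1) n * kummer_coeff \<alpha> \<beta> n * z ^ n" by (simp only:)
    then show ?thesis by (simp add: kummer_coeff_def mult_ac)
  qed
  then show ?thesis unfolding hypergeo_2F2_def by (simp only:)
qed

lemma summable_hypergeo_2F2:
  assumes "\<beta> \<notin> \<int>" "s > 0"
  shows "summable (\<lambda>n. s / (s + real n) * kummer_coeff \<alpha> \<beta> n * z ^ n)"
proof (rule summable_comparison_test')
  show "summable (\<lambda>n. norm (kummer_coeff \<alpha> \<beta> n * z ^ n))"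
    by (rule powser_insidea[OF summable_kummer[OF assms(1), of \<alpha> "\<bar>z\<bar> + 1"]]) simp
  fix n :: nat assume "n \<ge> 0"
  have "\<bar>s / (s + real n)\<bar> \<le> 1" using assms(2) by simp
  then show "norm (s / (s + real n) * kummer_coeff \<alpha> \<beta> n * z ^ n) \<le> norm (kummer_coeff \<alpha> \<beta> n * z ^ n)"
    unfolding norm_mult by (intro mult_right_mono mult_left_le_one_le) auto
qed

lemma hypergeo_2F2_has_derivative:
  assumes "\<beta> \<notin> \<int>" "s > 0" "z > 0"
  shows "((\<lambda>z. z powr s * hypergeo_2F2 \<alpha> s \<beta> (s + 1) z) has_real_derivative
    s * z powr (s - 1) * Kummer_M \<alpha> \<beta> z) (at z)"
proof -
  define d where "d n = s / (s + real n) * kummer_coeff \<alpha> \<beta> n" for n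
  have "(s + real n) * d n = s * kummer_coeff \<alpha> \<beta> n" for n
    using assms(2) by (simp add: d_def add_pos_nonneg)
  then have "(\<Sum>n. (s + real n) * d n * z ^ n) = s * Kummer_M \<alpha> \<beta> z"
    using sums_mult[OF sums_kummer[OF assms(1), of \<alpha> z], of s] by (simp add: sums_iff mult.assoc[of s])
  moreover have "summable (\<lambda>n. d n * z ^ n)" for z
    unfolding d_def by (rule summable_hypergeo_2F2[OF assms(1,2)])
  ultimately show ?thesis
    using powr_power_series_has_derivative[of d z s] assms(3)
    by (simp add: hypergeo_2F2_conv_kummer_coeff[OF assms(2)] d_def mult_ac)
qed

lemma isCont_hypergeo_2F2:
  assumes "\<beta> \<notin> \<int>" "s > 0"
  shows "isCont (hypergeo_2F2 \<alpha> s \<beta> (s + 1)) z"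
proof -
  have "hypergeo_2F2 \<alpha> s \<beta> (s + 1) = (\<lambda>z. \<Sum>n. s / (s + real n) * kummer_coeff \<alpha> \<beta> n * z ^ n)"
    by (rule ext) (rule hypergeo_2F2_conv_kummer_coeff[OF assms(2)])
  then show ?thesis
    using isCont_powser_converges_everywhere[OF summable_hypergeo_2F2[OF assms]] by simp
qed

lemma hypergeo_2F2_powr_has_derivative:
  assumes "\<beta> \<notin> \<int>" "s > 0" "t > 0" "\<kappa> > 0" "q > 0"
  shows "((\<lambda>t. t powr (s * q) / (s * q) * hypergeo_2F2 \<alpha> s \<beta> (s + 1) (\<kappa> * t powr q)) has_real_derivative
    t powr (s * q - 1) * Kummer_M \<alpha> \<beta> (\<kappa> * t powr q)) (at t)"
proof -
  \<comment> \<open>Chosen so that \<open>k * (\<kappa> * t powr q) powr s\<close> becomes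
    \<open>t powr (s * q) / (s * q)\<close>.\<close>
  define k where "k = 1 / (\<kappa> powr s * (s * q))"
  have z: "\<kappa> * t powr q > 0" using assms by simp
  have g: "((\<lambda>t. \<kappa> * t powr q) has_real_derivative \<kappa> * (q * t powr (q - 1))) (at t)"
    using assms by (auto intro!: derivative_eq_intros)
  have "((\<lambda>t. k * ((\<kappa> * t powr q) powr s * hypergeo_2F2 \<alpha> s \<beta> (s + 1) (\<kappa> * t powr q))) has_real_derivative
      k * (s * (\<kappa> * t powr q) powr (s - 1) * Kummer_M \<alpha> \<beta> (\<kappa> * t powr q) * (\<kappa> * (q * t powr (q - 1))))) (at t)"
    by (intro DERIV_cmult DERIV_chain2[OF hypergeo_2F2_has_derivative[OF assms(1,2) z] g])
  moreover have "k * (s * (\<kappa> * t powr q) powr (s - 1) * Kummer_M \<alpha> \<beta> (\<kappa> * t powr q) * (\<kappa> * (q * t powr (q - 1))))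
      = t powr (s * q - 1) * Kummer_M \<alpha> \<beta> (\<kappa> * t powr q)"
  proof -
    have "(\<kappa> * t powr q) powr (s - 1) = \<kappa> powr s / \<kappa> * t powr (s * q - q)"
      using assms by (simp add: powr_mult powr_powr powr_diff algebra_simps)
    moreover have "t powr (s * q - q) * t powr (q - 1) = t powr (s * q - 1)" by (simp flip: powr_add)
    moreover have "k * (s * (\<kappa> powr s / \<kappa> * u) * (\<kappa> * (q * v))) = u * v" for u v
      using assms by (simp add: k_def)
    ultimately have "k * (s * (\<kappa> * t powr q) powr (s - 1) * (\<kappa> * (q * t powr (q - 1)))) = t powr (s * q - 1)"
      by simp
    then show ?thesis by (metis mult.assoc mult.commute)
  qed
  ultimately have "((\<lambda>t. k * ((\<kappa> * t powr q) powr s * hypergeo_2F2 \<alpha> s \<beta> (s + 1) (\<kappa> * t powr q))) has_real_derivative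
      t powr (s * q - 1) * Kummer_M \<alpha> \<beta> (\<kappa> * t powr q)) (at t)" by simp
  then show ?thesis
  proof (rule has_field_derivative_transform_within_open[of _ _ _ "{0<..}"])
    fix t :: real assume "t \<in> {0<..}"
    then show "k * ((\<kappa> * t powr q) powr s * hypergeo_2F2 \<alpha> s \<beta> (s + 1) (\<kappa> * t powr q))
      = t powr (s * q) / (s * q) * hypergeo_2F2 \<alpha> s \<beta> (s + 1) (\<kappa> * t powr q)"
      using assms by (simp add: k_def powr_mult powr_powr mult_ac)
  qed (use assms in auto)
qed

text \<open>The closing field arithmetic, with all special values replaced by letters:
  \<open>f\<close> is \<open>phi q\<close>, \<open>r\<close> is \<open>sqrt (Gamma (1 / q))\<close>,
  \<open>X\<close> and \<open>Y\<close> are powers of \<open>\<xi>\<close>, \<open>k\<close> is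
  \<open>pi\<close>, \<open>S\<close> the cosecant, and the \<open>G\<close> letters are Gamma
  values.\<close>

lemma quotient_by_mean_eq:
  fixes q f r X Y T P S w h1 h2 Gab GA G1 G2 Ga Gb G2q Gam Gbp \<theta> N k :: real
  assumes "q > 0" "f > 0" "r > 0" "X > 0" "Y > 0" "w > 0" "Gab > 0" "GA > 0" "Ga > 0" "Gb > 0"
      "G2q > 0" "Gam > 0" "Gbp > 0" "N > 0" "\<theta> > 0" and ne: "G1 \<noteq> 0" "G2 \<noteq> 0"
  shows "N * GA * (k * S) * (\<theta>\<^sup>2 / 2 * h1 / (Gab * G1) - P / f * X / Y * (T * \<theta> / w * h2) / (GA * G2))
      / (N * G2q / (q * (f\<^sup>2 / X\<^sup>2)) * (Gam * Gbp / Gab)) =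
    k * \<theta> * q * (f * r) * (1 / (Y * X\<^sup>2)) * S / (2 * w * (r\<^sup>2 * r) * Gab * (Ga * Gb / Gab)) * (1 / (G2 * G1))
      * (r\<^sup>2 * Ga * Gb / (G2q * Gam * Gbp))
      * (\<theta> * Y * w * f * GA * G2 * h1 - 2 * X * Gab * T * G1 * P * h2)"
proof -
  \<comment> \<open>Collects the factors common to both sides; the normalising constant
    \<open>N\<close> cancels.\<close>
  define c where "c = k * \<theta> * q * f * S / (G2q * Gam * Gbp)"
  have C: "k * \<theta> * q * (f * r) * (1 / (Y * X\<^sup>2)) * S / (2 * w * (r\<^sup>2 * r) * Gab * (Ga * Gb / Gab)) * (1 / (G2 * G1))
      * (r\<^sup>2 * Ga * Gb / (G2q * Gam * Gbp)) = c / (2 * w * Y * X\<^sup>2 * G2 * G1)"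
    using assms by (simp add: c_def mult_ac)
  have "N * GA * (k * S) * (\<theta>\<^sup>2 / 2 * h1 / (Gab * G1) - P / f * X / Y * (T * \<theta> / w * h2) / (GA * G2))
      / (N * G2q / (q * (f\<^sup>2 / X\<^sup>2)) * (Gam * Gbp / Gab)) 
    = c * (f / X\<^sup>2 * GA * Gab * (\<theta> / 2 * h1 / (Gab * G1) - P / f * X / Y * (T / w * h2) / (GA * G2)))"
    using assms(1-15) by (simp add: c_def field_simps power2_eq_square)
  also have "f / X\<^sup>2 * GA * Gab * (\<theta> / 2 * h1 / (Gab * G1) - P / f * X / Y * (T / w * h2) / (GA * G2))
      = (\<theta> * Y * w * f * GA * G2 * h1 - 2 * X * Gab * T * G1 * P * h2) / (2 * w * Y * X\<^sup>2 * G2 * G1)"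
    using assms by (simp add: right_diff_distrib diff_divide_distrib mult_ac)
  finally show ?thesis unfolding C by simp
qed

section \<open>The Gambel distribution\<close>

lemma Beta_real_pos:
  fixes a b :: real
  assumes "a > 0" "b > 0"
  shows "Beta a b > 0"
  using assms by (auto simp: Beta_def intro!: divide_pos_pos mult_pos_pos Gamma_real_pos)

locale gambel_distribution =
  fixes q a b \<xi> :: real
  assumes q: "q > 0" and a: "a > 0" and b: "b > 0" and \<xi>: "\<xi> > 0"
    and notin_Ints: "b - 1 / q \<notin> \<int>"
begin

definition \<kappa> :: real where "\<kappa> = phi q powr q / \<xi>"

text \<open>The constant of the density once \<open>Gamma (a + 1 / q)\<close> has cancelled against
  the denominator of the integral representation.\<close>

definition N :: real where "N = q / (Gamma (1 / q) * Beta a b) * (phi q / \<xi> powr (1 / q))"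

definition dens :: "real \<Rightarrow> real" where "dens = gambel_density q a b \<xi>"

lemma phi_pos: "phi q > 0"
  unfolding phi_def using q by (simp add: Gamma_real_pos)

lemma \<kappa>_pos: "\<kappa> > 0"
  unfolding \<kappa>_def using phi_pos \<xi> by simp

lemma N_pos: "N > 0"
  unfolding N_def using phi_pos \<xi> q Gamma_real_pos[of "1 / q"] Beta_real_pos[OF a b] by simp

lemma \<kappa>_powr: "\<kappa> powr s = phi q powr (q * s) / \<xi> powr s"
  unfolding \<kappa>_def using phi_pos \<xi> by (simp add: powr_divide powr_powr)

lemma arg_eq: "\<theta> > 0 \<Longrightarrow> (phi q * \<theta>) powr q / \<xi> = \<kappa> * \<theta> powr q"
  unfolding \<kappa>_def using phi_pos by (simp add: powr_mult)

lemma dens_pos: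
  assumes "\<theta> > 0"
  shows "dens \<theta> = N * Gamma (a + 1 / q) * Tricomi_Psi (a + 1 / q) (1 + 1 / q - b) (\<kappa> * \<theta> powr q)"
  using assms unfolding dens_def gambel_density_def arg_eq[OF assms] N_def by simp

lemma second_notin_Ints: "1 + 1 / q - b \<notin> \<int>"
  using minus_notin_Ints[OF notin_Ints, of 1] by (simp add: algebra_simps)

text \<open>The integral representation at \<open>x = a + 1 / q\<close>,
  \<open>y = 1 + 1 / q - b\<close>, where \<open>1 + x - y = a + b > 0\<close>. Sign, measurability,
  continuity and moments of the density are all read off this form.\<close>

lemma dens_eq: "dens \<theta> = indicator {0<..} \<theta> * (N * confluent_integral (a + 1 / q) (- (a + b)) (\<kappa> * \<theta> powr q))"
proof (cases "\<theta> > 0")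
  case True
  have aq: "a + 1 / q > 0" using a q by (simp add: add_pos_pos)
  have "Tricomi_Psi (a + 1 / q) (1 + 1 / q - b) (\<kappa> * \<theta> powr q) =
      confluent_integral (a + 1 / q) (1 + 1 / q - b - (a + 1 / q) - 1) (\<kappa> * \<theta> powr q) / Gamma (a + 1 / q)"
    by (rule Tricomi_Psi_integral) (use second_notin_Ints aq a b \<kappa>_pos True in auto)
  moreover have "1 + 1 / q - b - (a + 1 / q) - 1 = - (a + b)" by simp
  moreover have "Gamma (a + 1 / q) > 0" using aq by (rule Gamma_real_pos)
  ultimately show ?thesis using True by (simp only: dens_pos) simp
qed (simp add: dens_def gambel_density_def)

lemma dens_nonneg: "dens \<theta> \<ge> 0"
  using N_pos confluent_integral_nonneg by (simp add: dens_eq)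

lemma dens_measurable [measurable]: "dens \<in> borel_measurable borel"
proof -
  have "dens = (\<lambda>\<theta>. indicator {0<..} \<theta> * (N * confluent_integral (a + 1 / q) (- (a + b)) (\<kappa> * \<theta> powr q)))"
    by (rule ext) (rule dens_eq)
  also have "\<dots> \<in> borel_measurable borel" by measurable
  finally show ?thesis .
qed

text \<open>\<open>s = 1\<close> will give the total mass and \<open>s = 2\<close> the mean.\<close>

lemma nn_integral_moment:
  assumes "s > 0" "a + 1 / q - s / q > 0" "a + b - (a + 1 / q - s / q) > 0"
  shows "(\<integral>\<^sup>+\<theta>. ennreal (\<theta> powr (s - 1) * dens \<theta>) \<partial>lborel) =
    ennreal (N * (Gamma (s / q) / (q * \<kappa> powr (s / q)) * Beta (a + 1 / q - s / q) (a + b - (a + 1 / q - s / q))))"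
proof -
  have "(\<integral>\<^sup>+\<theta>. ennreal (\<theta> powr (s - 1) * dens \<theta>) \<partial>lborel) =
    (\<integral>\<^sup>+\<theta>. ennreal N * (ennreal (\<theta> powr (s - 1) * confluent_integral (a + 1 / q) (- (a + b)) (\<kappa> * \<theta> powr q))
      * indicator {0<..} \<theta>) \<partial>lborel)"
    using N_pos confluent_integral_nonneg
    by (intro nn_integral_cong) (auto simp: dens_eq ennreal_mult[symmetric] mult_ac split: split_indicator)
  also have "\<dots> = ennreal N * ennreal (Gamma (s / q) / (q * \<kappa> powr (s / q)) * Beta (a + 1 / q - s / q) (a + b - (a + 1 / q - s / q)))"
    by (subst nn_integral_cmult) (auto simp only: nn_integral_confluent_moment[OF assms(1) q \<kappa>_pos assms(2,3)], measurable)
  also have "\<dots> = ennreal (N * (Gamma (s / q) / (q * \<kappa> powr (s / q)) * Beta (a + 1 / q - s / q) (a + b - (a + 1 / q - s / q))))"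
    using N_pos by (intro ennreal_mult'[symmetric]) simp
  finally show ?thesis .
qed

lemma gambel_eq: "gambel q a b \<xi> = density lborel (\<lambda>\<theta>. ennreal (dens \<theta>))"
  unfolding gambel_def dens_def ..

lemma prob_space_gambel: "prob_space (gambel q a b \<xi>)"
proof (rule prob_spaceI)
  have "emeasure (gambel q a b \<xi>) (space (gambel q a b \<xi>)) = (\<integral>\<^sup>+\<theta>. ennreal (dens \<theta>) \<partial>lborel)"
    unfolding gambel_eq by (simp add: emeasure_density)
  \<comment> \<open>\<open>\<theta> powr 0\<close> is 1 except at \<open>\<theta> = 0\<close>, where
    \<open>dens\<close> vanishes.\<close>
  also have "\<dots> = (\<integral>\<^sup>+\<theta>. ennreal (\<theta> powr (1 - 1) * dens \<theta>) \<partial>lborel)"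
    by (intro nn_integral_cong) (auto simp: dens_eq split: split_indicator)
  also have "\<dots> = ennreal (N * (Gamma (1 / q) / (q * \<kappa> powr (1 / q)) * Beta a b))"
    using nn_integral_moment[of 1] a b by simp
  also have "N * (Gamma (1 / q) / (q * \<kappa> powr (1 / q)) * Beta a b) = 1"
  proof -
    have "q / (g * B) * (f / x) * (g / (q * (f / x)) * B) = 1" if "g > 0" "f > 0" "x > 0" "B > 0" for g f x B
      using that q by simp
    moreover have "Gamma (1 / q) > 0" using q by (intro Gamma_real_pos) simp
    moreover have "\<kappa> powr (1 / q) = phi q / \<xi> powr (1 / q)" using q phi_pos by (simp add: \<kappa>_powr)
    ultimately show ?thesis
      using \<xi> phi_pos Beta_real_pos[OF a b] unfolding N_def by simp
  qed
  finally show "emeasure (gambel q a b \<xi>) (space (gambel q a b \<xi>)) = 1" by simp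
qed

lemma quantile_nonneg:
  assumes "0 < p" "p < 1"
  shows "quantile (cdf (gambel q a b \<xi>)) p \<ge> 0"
proof -
  interpret prob_space "gambel q a b \<xi>" by (rule prob_space_gambel)
  interpret real_distribution "gambel q a b \<xi>"
    by unfold_locales (simp add: gambel_eq)
  have "eventually (\<lambda>x. cdf (gambel q a b \<xi>) x > p) at_top"
    using order_tendstoD(1)[OF cdf_lim_at_top_prob assms(2)] .
  then obtain x where "cdf (gambel q a b \<xi>) x > p"
    using eventually_happens'[OF trivial_limit_at_top_linorder] by blast
  \<comment> \<open>Without this the infimum of reals would be an uninformative default
    value.\<close>
  then have "{x. cdf (gambel q a b \<xi>) x \<ge> p} \<noteq> {}" by (auto intro: less_imp_le)
  moreover have "x \<ge> 0" if "cdf (gambel q a b \<xi>) x \<ge> p" for x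
  proof (rule ccontr)
    assume x: "\<not> x \<ge> 0"
    have "emeasure (gambel q a b \<xi>) {..x} = (\<integral>\<^sup>+\<theta>. ennreal (dens \<theta>) * indicator {..x} \<theta> \<partial>lborel)"
      unfolding gambel_eq by (rule emeasure_density) auto
    also have "\<dots> = (\<integral>\<^sup>+\<theta>. 0 \<partial>(lborel :: real measure))"
      using x by (intro nn_integral_cong) (auto simp: dens_eq split: split_indicator)
    finally have "cdf (gambel q a b \<xi>) x = 0" by (simp add: cdf_def measure_def)
    then show False using that assms by simp
  qed
  ultimately show ?thesis unfolding quantile_def by (intro cInf_greatest) auto
qed

text \<open>The moment for \<open>s = 2\<close>; \<open>a > 1 / q\<close> makes the first Beta
  parameter positive, so the mean is finite.\<close>

lemma mean_eq:
  assumes "a > 1 / q"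
  shows "(LBINT \<theta>:{0<..}. \<theta> * dens \<theta>) = N * Gamma (2 / q) / (q * \<kappa> powr (2 / q)) * Beta (a - 1 / q) (b + 1 / q)"
    (is "_ = ?m")
proof -
  have aq: "a - 1 / q > 0" "b + 1 / q > 0" "2 / q > 0" using assms b q by (auto simp: add_pos_pos)
  have e: "a + 1 / q - 2 / q = a - 1 / q" "a + b - (a - 1 / q) = b + 1 / q"
    using q by (auto simp: field_simps)
  have m: "?m \<ge> 0"
    using N_pos \<kappa>_pos q Gamma_real_pos[OF aq(3)] Beta_real_pos[OF aq(1,2)] by simp
  have "(LBINT \<theta>:{0<..}. \<theta> * dens \<theta>) = (LINT \<theta>|lborel. \<theta> powr (2 - 1) * dens \<theta>)"
    unfolding set_lebesgue_integral_def
    by (intro Bochner_Integration.integral_cong) (auto simp: dens_eq split: split_indicator)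
  also have "\<dots> = enn2real (\<integral>\<^sup>+\<theta>. ennreal (\<theta> powr (2 - 1) * dens \<theta>) \<partial>lborel)"
    by (rule integral_eq_nn_integral) (auto simp: dens_nonneg)
  also have "(\<integral>\<^sup>+\<theta>. ennreal (\<theta> powr (2 - 1) * dens \<theta>) \<partial>lborel) = ennreal ?m"
    using nn_integral_moment[of 2] aq unfolding e by (simp only: e mult.assoc times_divide_eq_left times_divide_eq_right)
  finally show ?thesis using m by simp
qed

section \<open>The numerator of the Lorenz curve\<close>

text \<open>The antiderivative of \<open>\<theta> * dens \<theta>\<close> that vanishes at 0. The
  two Kummer terms of the Tricomi function are integrated with \<open>s = 2 / q\<close> and
  \<open>s = b + 1 / q\<close>, so that \<open>s * q\<close> is \<open>2\<close> and
  \<open>b * q + 1\<close>.\<close>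

definition partial_mean :: "real \<Rightarrow> real" where
  "partial_mean t = N * Gamma (a + 1 / q) * (pi / sin (pi * (1 + 1 / q - b))) *
    (t powr 2 / 2 * hypergeo_2F2 (a + 1 / q) (2 / q) (1 + 1 / q - b) (2 / q + 1) (\<kappa> * t powr q)
        / (Gamma (a + b) * Gamma (1 + 1 / q - b))
     - \<kappa> powr (b - 1 / q) * (t powr (b * q + 1) / (b * q + 1) *
        hypergeo_2F2 (a + b) (b + 1 / q) (b - 1 / q + 1) (b + 1 / q + 1) (\<kappa> * t powr q))
        / (Gamma (a + 1 / q) * Gamma (b - 1 / q + 1)))"

lemma partial_mean_has_derivative:
  assumes t: "t > 0"
  shows "(partial_mean has_real_derivative t * dens t) (at t)"
proof -
  have Z: "b - 1 / q + 1 \<notin> \<int>" using notin_Ints by simp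
  have e: "2 / q * q = 2" "(b + 1 / q) * q = b * q + 1" "2 - 1 = (1 :: real)" "b * q + 1 - 1 = b * q"
    using q by (auto simp: field_simps)
  have e': "1 + (a + 1 / q) - (1 + 1 / q - b) = a + b" "1 - (1 + 1 / q - b) = b - 1 / q" "2 - (1 + 1 / q - b) = b - 1 / q + 1"
    by simp_all
  have bq: "b + 1 / q > 0" "2 / q > 0" using b q by (auto simp: add_pos_pos)
  note d1 = hypergeo_2F2_powr_has_derivative[OF second_notin_Ints bq(2) t \<kappa>_pos q, of "a + 1 / q", unfolded e]
  note d2 = hypergeo_2F2_powr_has_derivative[OF Z bq(1) t \<kappa>_pos q, of "a + b", unfolded e]
  let ?D = "N * Gamma (a + 1 / q) * (pi / sin (pi * (1 + 1 / q - b))) *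
    (t powr 1 * Kummer_M (a + 1 / q) (1 + 1 / q - b) (\<kappa> * t powr q)
        / (Gamma (a + b) * Gamma (1 + 1 / q - b))
     - \<kappa> powr (b - 1 / q) * (t powr (b * q) * Kummer_M (a + b) (b - 1 / q + 1) (\<kappa> * t powr q))
        / (Gamma (a + 1 / q) * Gamma (b - 1 / q + 1)))"
  have der: "(partial_mean has_real_derivative ?D) (at t)"
    unfolding partial_mean_def[abs_def] by (intro DERIV_cmult DERIV_diff DERIV_cdivide d1 d2)
  \<comment> \<open>The prefactor \<open>z powr (1 - y)\<close> of the second Kummer term, times the
    \<open>t\<close> of the mean, is the power under the second integral.\<close>
  have p: "(\<kappa> * t powr q) powr (b - 1 / q) * t = \<kappa> powr (b - 1 / q) * t powr (b * q)"
  proof -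
    have "t powr (q * (b - 1 / q)) * t = t powr (q * (b - 1 / q) + 1)"
      using t powr_add[of t "q * (b - 1 / q)" 1] by simp
    also have "q * (b - 1 / q) + 1 = b * q" using q by (simp add: field_simps)
    finally show ?thesis using \<kappa>_pos t by (simp add: powr_mult powr_powr)
  qed
  have key: "n * S * (t powr 1 * M / g1 - k * (T * M') / g2) = t * (n * (S * (M / g1 - Z * M' / g2)))"
    if "Z * t = k * T" for n S M M' g1 g2 k T Z
  proof -
    have 1: "k * (T * M') = Z * t * M'" by (simp add: that flip: mult.assoc)
    have 2: "t * (n * (S * (M / g1 - Z * M' / g2))) = n * S * (t * M / g1 - Z * t * M' / g2)"
      by (simp add: algebra_simps)
    show ?thesis unfolding 1 2 using t by simp
  qed
  have "?D = t * dens t"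
    unfolding dens_pos[OF t] Tricomi_Psi_def e' by (rule key[OF p])
  with der show ?thesis by simp
qed

lemma partial_mean_at_0: "(partial_mean \<longlongrightarrow> 0) (at_right 0)"
proof -
  have Z: "b - 1 / q + 1 \<notin> \<int>" using notin_Ints by simp
  have s: "b + 1 / q > 0" "2 / q > 0" "b * q + 1 > 0" using b q by (auto simp: add_pos_pos)
  have arg: "((\<lambda>t. \<kappa> * t powr q) \<longlongrightarrow> 0) (at_right 0)"
    using tendsto_mult[OF tendsto_const[of \<kappa>] tendsto_powr_at_right_0[OF q]] by simp
  have h1: "((\<lambda>t. t powr 2 * hypergeo_2F2 (a + 1 / q) (2 / q) (1 + 1 / q - b) (2 / q + 1) (\<kappa> * t powr q)) \<longlongrightarrow> 0) (at_right 0)"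
    using tendsto_mult[OF tendsto_powr_at_right_0[of 2] isCont_tendsto_compose[OF isCont_hypergeo_2F2[OF second_notin_Ints s(2)] arg]]
    by simp
  have h2: "((\<lambda>t. t powr (b * q + 1) * hypergeo_2F2 (a + b) (b + 1 / q) (b - 1 / q + 1) (b + 1 / q + 1) (\<kappa> * t powr q)) \<longlongrightarrow> 0) (at_right 0)"
    using tendsto_mult[OF tendsto_powr_at_right_0[OF s(3)] isCont_tendsto_compose[OF isCont_hypergeo_2F2[OF Z s(1)] arg]]
    by simp
  define u1 u2 where "u1 = 1 / 2 / (Gamma (a + b) * Gamma (1 + 1 / q - b))"
    and "u2 = \<kappa> powr (b - 1 / q) / (b * q + 1) / (Gamma (a + 1 / q) * Gamma (b - 1 / q + 1))"
  have "partial_mean = (\<lambda>t. N * Gamma (a + 1 / q) * (pi / sin (pi * (1 + 1 / q - b))) *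
    (u1 * (t powr 2 * hypergeo_2F2 (a + 1 / q) (2 / q) (1 + 1 / q - b) (2 / q + 1) (\<kappa> * t powr q))
     - u2 * (t powr (b * q + 1) * hypergeo_2F2 (a + b) (b + 1 / q) (b - 1 / q + 1) (b + 1 / q + 1) (\<kappa> * t powr q))))"
    by (simp add: fun_eq_iff partial_mean_def u1_def u2_def)
  moreover have "(\<dots> \<longlongrightarrow> N * Gamma (a + 1 / q) * (pi / sin (pi * (1 + 1 / q - b))) * (u1 * 0 - u2 * 0)) (at_right 0)"
    by (intro tendsto_intros h1 h2)
  ultimately show ?thesis by simp
qed

lemma partial_mean_eq:
  assumes "t > 0"
  shows "(LBINT \<theta>:{0<..t}. \<theta> * dens \<theta>) = partial_mean t"
proof -
  have "(LBINT \<theta>=ereal 0..ereal t. \<theta> * dens \<theta>) = partial_mean t - 0"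
  \<comment> \<open>For a nonnegative integrand, an antiderivative with limits at both ends
    suffices; integrability follows.\<close>
  proof (rule interval_integral_FTC_nonneg(2))
    fix x assume "ereal 0 < ereal x"
    then have x: "x > 0" by simp
    show "(partial_mean has_real_derivative x * dens x) (at x)"
      by (rule partial_mean_has_derivative[OF x])
    have "a + 1 / q > 0" "\<kappa> * x powr q > 0" using a q x \<kappa>_pos by (auto simp: add_pos_pos)
    then have "isCont (confluent_integral (a + 1 / q) (- (a + b))) (\<kappa> * x powr q)"
      by (rule DERIV_isCont[OF confluent_integral_has_derivative])
    then have "isCont (\<lambda>x. confluent_integral (a + 1 / q) (- (a + b)) (\<kappa> * x powr q)) x"
      by (rule isCont_o2[rotated]) (use x in \<open>auto intro!: continuous_intros\<close>)
    then have "isCont (\<lambda>x. x * (N * confluent_integral (a + 1 / q) (- (a + b)) (\<kappa> * x powr q))) x"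
      by (intro continuous_intros)
    \<comment> \<open>Near \<open>x > 0\<close> the indicator in \<open>dens_eq\<close> is
      1.\<close>
    moreover have "eventually (\<lambda>x. x * dens x = x * (N * confluent_integral (a + 1 / q) (- (a + b)) (\<kappa> * x powr q))) (nhds x)"
      by (rule eventually_nhds_in_open[of "{0<..}", THEN eventually_mono]) (use x in \<open>auto simp: dens_eq\<close>)
    ultimately show "isCont (\<lambda>x. x * dens x) x" by (simp only: isCont_cong)
  next
    show "((partial_mean \<circ> real_of_ereal) \<longlongrightarrow> 0) (at_right (ereal 0))"
      unfolding ereal_tendsto_simps1 by (rule partial_mean_at_0)
    have "isCont partial_mean t"
      by (rule DERIV_isCont[OF partial_mean_has_derivative[OF assms]])
    then show "((partial_mean \<circ> real_of_ereal) \<longlongrightarrow> partial_mean t) (at_left (ereal t))"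
      unfolding ereal_tendsto_simps1 by (simp add: isCont_def filterlim_at_split)
  qed (use assms in \<open>auto simp: dens_nonneg intro!: AE_I2 mult_nonneg_nonneg\<close>)
  then show ?thesis using assms by (simp add: interval_integral_Ioc)
qed

end

section \<open>The Lorenz curve\<close>

theorem theorem4:
  fixes q a b \<xi> p \<theta> C :: real and F :: "real \<Rightarrow> real"
  assumes "q > 0" and "a > 0" and "b > 0" and "\<xi> > 0"
    and "a > 1 / q"
    and "b - 1 / q \<notin> \<int>"
    and "F = cdf (gambel q a b \<xi>)"
    and "0 < p" and "p < 1"
    and "\<theta> = quantile F p"
    and "C =
        (pi * \<theta> * q * sqrt (Gamma (3 / q)) * \<xi> powr (- ((b * q + 2) / q))
           * (1 / sin (pi * (b - 1 / q))))
          / (2 * (b * q + 1) * Gamma (1 / q) powr (3 / 2) * Gamma (a + b) * Beta a b)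
        * (1 / (Gamma (b - 1 / q + 1) * Gamma (- b + 1 / q + 1)))
        * ((Gamma (1 / q) * Gamma a * Gamma b)
           / (Gamma (2 / q) * Gamma (a - 1 / q) * Gamma (b + 1 / q)))"
  shows "lorenz_curve (gambel_density q a b \<xi>) p =
      C * (\<theta> * \<xi> powr b * (b * q + 1) * phi q * Gamma (a + 1 / q) * Gamma (b - 1 / q + 1)
             * hypergeo_2F2 (a + 1 / q) (2 / q) (- b + 1 / q + 1) (1 + 2 / q)
                 (phi q powr q * \<theta> powr q / \<xi>)
           - 2 * \<xi> powr (1 / q) * Gamma (a + b) * \<theta> powr (b * q) * Gamma (- b + 1 / q + 1)
             * phi q powr (b * q)
             * hypergeo_2F2 (a + b) (b + 1 / q) (b - 1 / q + 1) (b + 1 / q + 1)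
                 (phi q powr q * \<theta> powr q / \<xi>))"
proof -
  interpret gambel_distribution q a b \<xi>
    by unfold_locales (use assms in auto)
  have lor: "lorenz_curve (gambel_density q a b \<xi>) p =
      (LBINT x:{0<..\<theta>}. x * dens x) / (LBINT x:{0<..}. x * dens x)"
    unfolding lorenz_curve_def assms(10,7) gambel_def dens_def ..
  have "\<theta> \<ge> 0" using quantile_nonneg[OF assms(8,9)] assms(7,10) by simp
  then consider "\<theta> = 0" | "\<theta> > 0" by linarith
  then show ?thesis
  proof cases
    \<comment> \<open>The interval of integration is empty, and \<open>C\<close> contains the factor
      \<open>\<theta>\<close>.\<close>
    case 1
    then show ?thesis unfolding lor assms(11) by (simp add: set_lebesgue_integral_def)
  next
    case 2
    define r X Y T P S w where "r = sqrt (Gamma (1 / q))" and "X = \<xi> powr (1 / q)" and "Y = \<xi> powr b"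
      and "T = \<theta> powr (b * q)" and "P = phi q powr (b * q)" and "S = 1 / sin (pi * (b - 1 / q))"
      and "w = b * q + 1"
    define h1 h2 where "h1 = hypergeo_2F2 (a + 1 / q) (2 / q) (1 + 1 / q - b) (2 / q + 1) (\<kappa> * \<theta> powr q)"
      and "h2 = hypergeo_2F2 (a + b) (b + 1 / q) (b - 1 / q + 1) (b + 1 / q + 1) (\<kappa> * \<theta> powr q)"
    define Gab GA G1 G2 Ga Gb G2q Gam Gbp where "Gab = Gamma (a + b)" and "GA = Gamma (a + 1 / q)"
      and "G1 = Gamma (1 + 1 / q - b)" and "G2 = Gamma (b - 1 / q + 1)" and "Ga = Gamma a" and "Gb = Gamma b"
      and "G2q = Gamma (2 / q)" and "Gam = Gamma (a - 1 / q)" and "Gbp = Gamma (b + 1 / q)"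
    have "1 / q > 0" "2 / q > 0" using assms(1) by auto
    then have pos: "r > 0" "X > 0" "Y > 0" "T > 0" "P > 0" "w > 0" "Gab > 0" "GA > 0" "Ga > 0" "Gb > 0"
      "G2q > 0" "Gam > 0" "Gbp > 0"
      unfolding r_def X_def Y_def T_def P_def w_def Gab_def GA_def Ga_def Gb_def G2q_def Gam_def Gbp_def
      using assms 2 phi_pos by (auto intro!: Gamma_real_pos add_pos_pos)
    have ne: "G1 \<noteq> 0" "G2 \<noteq> 0"
      using second_notin_Ints assms(6) unfolding G1_def G2_def
      by (auto simp: Gamma_eq_zero_iff dest!: nonpos_Ints_Int)
    \<comment> \<open>The sine of the Tricomi function and that of the stated cosecant have
      arguments adding up to \<open>pi\<close>.\<close>
    have S: "1 / sin (pi * (1 + 1 / q - b)) = S"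
    proof -
      have "sin (pi * (1 + 1 / q - b)) = sin (pi - pi * (b - 1 / q))" by (simp add: algebra_simps)
      then show ?thesis by (simp only: sin_pi_minus S_def)
    qed
    have k1: "\<kappa> powr (b - 1 / q) = P / phi q * X / Y"
    proof -
      have "q * (b - 1 / q) = b * q - 1" using assms(1) by (simp add: field_simps)
      then show ?thesis
        using phi_pos assms(4) unfolding \<kappa>_powr by (simp only: P_def X_def Y_def powr_diff) simp
    qed
    have k2: "\<kappa> powr (2 / q) = (phi q)\<^sup>2 / X\<^sup>2"
    proof -
      have "\<xi> powr (2 / q) = X\<^sup>2"
        using powr_add[of \<xi> "1 / q" "1 / q"] by (simp add: X_def power2_eq_square)
      then show ?thesis
        using phi_pos assms(1) by (simp add: \<kappa>_powr powr_numeral)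
    qed
    have x1: "\<xi> powr (- ((b * q + 2) / q)) = 1 / (Y * X\<^sup>2)"
    proof -
      have "- ((b * q + 2) / q) = - b + - (1 / q) + - (1 / q)" using assms(1) by (simp add: field_simps)
      then show ?thesis by (simp only: powr_minus powr_add) (simp add: X_def Y_def power2_eq_square field_simps)
    qed
    have sq: "sqrt (Gamma (3 / q)) = phi q * r"
      using pos(1) by (simp add: phi_def r_def real_sqrt_divide)
    have G32: "Gamma (1 / q) powr (3 / 2) = r\<^sup>2 * r" "Gamma (1 / q) = r\<^sup>2"
    proof -
      have g: "Gamma (1 / q) > 0" using \<open>1 / q > 0\<close> by (rule Gamma_real_pos)
      show r2: "Gamma (1 / q) = r\<^sup>2" unfolding r_def using g by simp
      have "Gamma (1 / q) powr (3 / 2) = Gamma (1 / q) powr (1 + 1 / 2)" by simp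
      also have "\<dots> = Gamma (1 / q) * sqrt (Gamma (1 / q))"
        using g unfolding powr_add by (simp add: powr_half_sqrt)
      also have "\<dots> = r\<^sup>2 * r" unfolding r_def using g by simp
      finally show "Gamma (1 / q) powr (3 / 2) = r\<^sup>2 * r" .
    qed
    have B: "Beta a b = Ga * Gb / Gab" "Beta (a - 1 / q) (b + 1 / q) = Gam * Gbp / Gab"
      by (simp_all add: Beta_def Ga_def Gb_def Gab_def Gam_def Gbp_def)
    have pm: "partial_mean \<theta> = N * GA * (pi * S) *
      (\<theta>\<^sup>2 / 2 * h1 / (Gab * G1) - P / phi q * X / Y * (T * \<theta> / w * h2) / (GA * G2))"
    proof -
      have "\<theta> powr (b * q + 1) = T * \<theta>" "\<theta> powr 2 = \<theta>\<^sup>2"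
        using 2 by (simp_all add: T_def powr_add)
      moreover have "pi / sin (pi * (1 + 1 / q - b)) = pi * S" unfolding S[symmetric] by simp
      ultimately show ?thesis
        unfolding partial_mean_def k1 by (simp only: Gab_def GA_def G1_def G2_def h1_def h2_def w_def)
    qed
    have e: "- b + 1 / q + 1 = 1 + 1 / q - b" "1 + 2 / q = 2 / q + 1" "phi q powr q * \<theta> powr q / \<xi> = \<kappa> * \<theta> powr q"
      by (simp_all add: \<kappa>_def)
    show ?thesis
      \<comment> \<open>\<open>Gamma (1 / q) powr (3 / 2)\<close> is rewritten first, since
        replacing \<open>Gamma (1 / q)\<close> would destroy its pattern.\<close>
      unfolding lor partial_mean_eq[OF 2] mean_eq[OF assms(5)] assms(11) e x1 sq G32(1)
      unfolding G32(2) B pm k2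
        S_def[symmetric] X_def[symmetric] Y_def[symmetric] T_def[symmetric] P_def[symmetric] w_def[symmetric]
        h1_def[symmetric] h2_def[symmetric] Gab_def[symmetric] GA_def[symmetric] G1_def[symmetric] G2_def[symmetric]
        Ga_def[symmetric] Gb_def[symmetric] G2q_def[symmetric] Gam_def[symmetric] Gbp_def[symmetric]
      by (rule quotient_by_mean_eq) (use pos ne phi_pos assms(1) 2 N_pos in auto)
  qed
qed

end
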